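(* Let $H$ and $G$ be separable real Hilbert spaces, let $Q\in L(H)$ be a nonnegative self-adjoint nuclear operator, and let $A\in L(G,H)$ be an injective bounded linear operator such that $U:=\operatorname{ran}(A)$ is closed in $H$ and $U$ and $U^\perp$ are $Q$-invariant. Consider the statistical model on $H$ with probability measures $\mathbb{Q}_\gamma=\mathrm{N}(A\beta,\sigma^2Q)$, $\gamma=(\beta,\sigma^2)\in G\times(0,\infty)$, with observation $Y$. Let $\widehat{\zeta}(Y):=\Pi_UY$ and $\widehat{\beta}(Y):=A^{-1}\widehat{\zeta}(Y)$. Assume $Q(\Pi_H-\Pi_U)\neq0$ and set $$\tau:=\operatorname{tr}(Q(\Pi_H-\Pi_U)),\qquad \lambda:=\|Q(\Pi_H-\Pi_U)\|,\qquad n:=\dim\ker(\lambda-Q(\Pi_H-\Pi_U)),$$ and let $\widehat{s}(Y)\ge0$ be given by $\widehat{s}^2(Y)=\|Y-\widehat{\zeta}(Y)\|^2/\operatorname{tr}(Q(\Pi_H-\Pi_U))$. Let $c\in G$ with $\langle Q(A^{-1})^*c,\Pi_U(A^{-1})^*c\rangle>0$ and $\alpha\in(0,1)$ be arbitrary. Then the random interval $$\langle c,\widehat{\beta}(Y)\rangle\pm\sqrt{\frac{\tau}{\lambda n}}\,t_{n,1-\frac{\alpha}{2}}\,\widehat{s}(Y)\sqrt{\langle Q(A^{-1})^*c,\Pi_U(A^{-1})^*c\rangle}$$ is a $(1-\alpha)$-confidence interval for $\langle c,\beta\rangle$.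
   Context: A subspace $V$ is $Q$-invariant if $Q(V)\subset V$. $\Pi_V$ is the orthogonal projection onto a closed subspace $V$; $\Pi_H$ is the identity, and $\lambda-Q(\Pi_H-\Pi_U)$ means $\lambda\Pi_H-Q(\Pi_H-\Pi_U)$. $A^{-1}\in L(U,G)$ is the inverse of the isomorphism $A:G\to U$, and $(A^{-1})^*\in L(G,U)$ is its adjoint. $\mathrm{N}(\xi,\sigma^2Q)$ is the Gaussian measure on $H$ with mean $\xi$ and covariance operator $\sigma^2Q$, i.e. if $Y$ has this law then $\langle b,Y\rangle\sim\mathrm{N}(\langle b,\xi\rangle,\sigma^2\langle Qb,b\rangle)$ (possibly degenerate) for all $b\in H$. $Y$ is the observation (the identity map on $H$). For $a\in(0,1)$, $t_{n,a}$ is the $a$-quantile of Student's $t$-distribution with $n$ degrees of freedom. The notation $x\pm r$ means $[x-r,x+r]$. A random interval $I(Y)$ is a $(1-\alpha)$-confidence interval for $\langle c,\beta\rangle$ if $\mathbb{Q}_\gamma(\langle c,\beta\rangle\in I(Y))\ge1-\alpha$ for every $\gamma=(\beta,\sigma^2)\in G\times(0,\infty)$. *)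

theory Defs
  imports "HOL-Probability.Probability"
begin

text \<open>
  A separable real Hilbert space is a type of sort \<open>{real_inner, polish_space}\<close>, i.e. an inner
  product space that is complete and second countable. Bounded linear operators are plain
  functions satisfying \<^const>\<open>bounded_linear\<close>; their operator norm is \<^const>\<open>onorm\<close>.
\<close>

subsection \<open>Operators on Hilbert spaces\<close>

definition self_adjoint :: "('a::real_inner \<Rightarrow> 'a) \<Rightarrow> bool" where
  "self_adjoint T \<longleftrightarrow> (\<forall>x y. inner (T x) y = inner x (T y))"

definition nonnegative_op :: "('a::real_inner \<Rightarrow> 'a) \<Rightarrow> bool" where
  "nonnegative_op T \<longleftrightarrow> (\<forall>x. 0 \<le> inner (T x) x)"

definition nuclear :: "('a::real_inner \<Rightarrow> 'a) \<Rightarrow> bool" where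
  "nuclear T \<longleftrightarrow> (\<exists>(a :: nat \<Rightarrow> 'a) (b :: nat \<Rightarrow> 'a).
     summable (\<lambda>i. norm (a i) * norm (b i)) \<and>
     (\<forall>x. (\<lambda>i. inner (a i) x *\<^sub>R b i) sums T x))"

definition orthonormal_basis :: "'a::real_inner set \<Rightarrow> bool" where
  "orthonormal_basis B \<longleftrightarrow>
     pairwise orthogonal B \<and> (\<forall>e\<in>B. norm e = 1) \<and> closure (span B) = UNIV"

text \<open>For nuclear operators on a Hilbert space the value does not depend on the chosen basis.\<close>

definition op_trace :: "('a::real_inner \<Rightarrow> 'a) \<Rightarrow> real" where
  "op_trace T = (\<Sum>\<^sub>\<infinity>e\<in>(SOME B. orthonormal_basis B). inner (T e) e)"

text \<open>
  \<open>orth_proj V\<close> is the orthogonal projection onto \<open>V\<close>; existence and uniqueness of the point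
  described here hold for closed subspaces of a Hilbert space.
\<close>

definition orth_proj :: "'a::real_inner set \<Rightarrow> 'a \<Rightarrow> 'a" where
  "orth_proj V x = (THE p. p \<in> V \<and> (\<forall>v\<in>V. inner (x - p) v = 0))"

text \<open>
  \<open>adjoint_on V T\<close> is the adjoint, as an operator into the Hilbert space \<open>V\<close>, of a bounded
  operator \<open>T\<close> defined on the closed subspace \<open>V\<close>. The values of \<open>T\<close> outside \<open>V\<close> are irrelevant.
\<close>

definition adjoint_on :: "'a::real_inner set \<Rightarrow> ('a \<Rightarrow> 'b::real_inner) \<Rightarrow> 'b \<Rightarrow> 'a" where
  "adjoint_on V T c = (THE u. u \<in> V \<and> (\<forall>w\<in>V. inner u w = inner c (T w)))"

subsection \<open>Gaussian measures\<close>

definition normal_law :: "real \<Rightarrow> real \<Rightarrow> real measure" where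
  "normal_law \<mu> v =
     (if v = 0 then return borel \<mu> else density lborel (\<lambda>x. ennreal (normal_density \<mu> (sqrt v) x)))"

text \<open>
  \<open>is_gaussian M \<xi> C\<close> states that \<open>M\<close> is the Gaussian measure with mean \<open>\<xi>\<close> and covariance
  operator \<open>C\<close> on the Borel sets. The one-dimensional marginals determine \<open>M\<close> on a separable
  Hilbert space.
\<close>

definition is_gaussian :: "'a::real_inner measure \<Rightarrow> 'a \<Rightarrow> ('a \<Rightarrow> 'a) \<Rightarrow> bool" where
  "is_gaussian M \<xi> C \<longleftrightarrow> prob_space M \<and> sets M = sets borel \<and>
     (\<forall>b. distr M borel (\<lambda>y. inner b y) = normal_law (inner b \<xi>) (inner (C b) b))"

subsection \<open>Student's t-distribution\<close>

definition student_t_density :: "nat \<Rightarrow> real \<Rightarrow> real" where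
  "student_t_density n x =
     Gamma ((real n + 1) / 2) / (sqrt (real n * pi) * Gamma (real n / 2)) *
     (1 + x\<^sup>2 / real n) powr (- (real n + 1) / 2)"

definition student_t :: "nat \<Rightarrow> real measure" where
  "student_t n = density lborel (\<lambda>x. ennreal (student_t_density n x))"

definition quantile :: "real measure \<Rightarrow> real \<Rightarrow> real" where
  "quantile M a = Inf {x. a \<le> cdf M x}"

subsection \<open>Confidence intervals\<close>

text \<open>
  The value of \<^const>\<open>measure\<close> is 0 on non-measurable sets, so for \<open>p > 0\<close> the bound
  includes the measurability of the covering event.
\<close>

definition confidence_interval ::
    "('p \<Rightarrow> 'a measure) \<Rightarrow> 'p set \<Rightarrow> ('p \<Rightarrow> real) \<Rightarrow> real \<Rightarrow> ('a \<Rightarrow> real set) \<Rightarrow> bool" where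
  "confidence_interval P \<Gamma> \<psi> p I \<longleftrightarrow>
     (\<forall>\<gamma>\<in>\<Gamma>. measure (P \<gamma>) {y \<in> space (P \<gamma>). \<psi> \<gamma> \<in> I y} \<ge> p)"

end

theory Submission
  imports Defs
begin

text \<open>
  The half-width of the interval is built so that the unknown scale \<sigma> cancels. Let w be the
  adjoint of \<open>A\<inverse>\<close> applied to c, a vector of U. Then the estimation error
  \<open>\<langle>c, \<beta>_hat Y\<rangle> - \<langle>c, \<beta>\<rangle> = \<langle>w, Y - A \<beta>\<rangle>\<close> is normal with mean 0 and variance \<open>\<sigma>\<^sup>2 q\<close>.
  The operator R is nonnegative, self-adjoint and nuclear, so its norm \<open>lam\<close> is an eigenvalue with
  an eigenspace of some finite dimension \<open>n \<ge> 1\<close>. This eigenspace is orthogonal to U; for an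
  orthonormal basis F of it the coordinates \<open>\<langle>e, Y\<rangle>\<close> with \<open>e \<in> F\<close> are normal with mean 0 and variance
  \<open>\<sigma>\<^sup>2 lam\<close>. All these variables are uncorrelated, because Q maps U to U and \<open>Q e = lam e\<close>, hence
  independent. Therefore

    \<open>T = (\<langle>w, Y - A \<beta>\<rangle> / sqrt (\<sigma>\<^sup>2 q)) / sqrt ((\<Sum>e\<in>F. \<langle>e, Y\<rangle>\<^sup>2 / (\<sigma>\<^sup>2 lam)) / n)\<close>

  has Student's t-distribution with n degrees of freedom. By Bessel's inequality the sum of the
  \<open>\<langle>e, Y\<rangle>\<^sup>2\<close> is at most \<open>\<parallel>Y - \<zeta> Y\<parallel>\<^sup>2\<close>, which equals \<open>\<tau> (s Y)\<^sup>2\<close>. So whenever \<open>\<bar>T\<bar>\<close> is at most the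
  quantile, the error is in absolute value at most the half-width of the interval, and the symmetry of the
  t-distribution gives this event probability at least \<open>1 - \<alpha>\<close>. The interval can be conservative, since
  only the top eigenspace of R enters T, while the whole residual \<open>Y - \<zeta> Y\<close> enters s.

  Three groups of facts carry the argument. On the Hilbert space side, a point of minimal energy gives
  the Riesz representation on closed subspaces (\<open>riesz_representation_closed_subspace\<close>), from which
  follow projections, orthonormal bases and, with Baire's theorem, the adjoint of \<open>A\<inverse>\<close>
  (\<open>adjoint_on_inverse\<close>); compactness of nuclear operators yields the eigenvalue
  (\<open>onorm_is_eigenvalue\<close>), and a bound on partial traces yields the finite dimension of its
  eigenspace (\<open>nuclear_eigenspace_orthonormal_basis\<close>). On the probabilistic side, a factorizing joint
  characteristic function implies independence (\<open>indep_vars_of_char_factor\<close>), which reduces everything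
  about the Gaussian measure to its one-dimensional marginals. Finally, explicit densities give the law
  of the studentized quotient (\<open>student_t_quotient\<close>).
\<close>

section \<open>Riesz representation and orthogonal projections\<close>

text \<open>
  The first-order condition at a minimum, in the form in which it is used for energies: near \<open>t = 0\<close> the
  linear term dominates, so it has to vanish.
\<close>

lemma quadratic_nonneg_imp_linear_coeff_0:
  fixes a d :: real
  assumes a: "0 \<le> a" and q: "\<And>t. 0 \<le> 2 * t * d + t\<^sup>2 * a"
  shows "d = 0"
proof -
  define s where "s = 1 + a"
  have s: "s > 0" using a by (simp add: s_def)
  have "0 \<le> 2 * (- d / s) * d + (- d / s)\<^sup>2 * a" by (rule q)
  also have "\<dots> = (d\<^sup>2 / s\<^sup>2) * (a - 2 * s)" using s by (simp add: field_simps power2_eq_square)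
  finally have "0 \<le> (d\<^sup>2 / s\<^sup>2) * (a - 2 * s)" .
  moreover have "a - 2 * s < 0" using a by (simp add: s_def)
  ultimately have "d\<^sup>2 / s\<^sup>2 \<le> 0" by (metis linorder_not_le mult_pos_neg)
  then show ?thesis using s by (simp add: divide_le_0_iff)
qed

text \<open>
  The representing vector minimizes the energy \<open>\<parallel>v\<parallel>\<^sup>2 - 2 f(v)\<close> over \<open>V\<close>. The parallelogram law
  makes every minimizing sequence Cauchy, and the first-order condition at the minimum is
  \<open>\<langle>u, v\<rangle> = f(v)\<close>. Working on a subspace has the projection theorem as the special case
  \<open>f = \<langle>x, \<cdot>\<rangle>\<close>.
\<close>

lemma riesz_representation_closed_subspace:
  fixes V :: "'a::{real_inner, complete_space} set" and f :: "'a \<Rightarrow> real"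
  assumes V: "subspace V" "closed V"
    and add: "\<And>v w. v \<in> V \<Longrightarrow> w \<in> V \<Longrightarrow> f (v + w) = f v + f w"
    and scale: "\<And>t v. v \<in> V \<Longrightarrow> f (t *\<^sub>R v) = t * f v"
    and bound: "\<And>v. v \<in> V \<Longrightarrow> \<bar>f v\<bar> \<le> K * norm v"
  shows "\<exists>u\<in>V. \<forall>v\<in>V. inner u v = f v"
proof -
  define J where "J v = (norm v)\<^sup>2 - 2 * f v" for v
  have low: "- K\<^sup>2 \<le> J v" if "v \<in> V" for v
  proof -
    have "0 \<le> (norm v - K)\<^sup>2" by simp
    with bound[OF that] show ?thesis unfolding J_def by (simp add: power2_diff abs_le_iff mult.commute)
  qed
  define m where "m = (INF v\<in>V. J v)"
  have bdd: "bdd_below (J ` V)" using low by (auto intro!: bdd_belowI)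
  have V0: "V \<noteq> {}" using V(1) subspace_0 by blast
  have m_le: "m \<le> J v" if "v \<in> V" for v
    unfolding m_def by (rule cINF_lower[OF bdd that])
  have "\<exists>v\<in>V. J v < m + 1 / real (Suc k)" for k
    using cInf_lessD[of "J ` V" "m + 1 / real (Suc k)"] V0 by (auto simp: m_def)
  then obtain v where v: "\<And>k. v k \<in> V" "\<And>k. J (v k) < m + 1 / real (Suc k)" by metis
  have par: "(norm (x - y))\<^sup>2 \<le> 2 * (J x - m) + 2 * (J y - m)" if "x \<in> V" "y \<in> V" for x y
  proof -
    (* parallelogram law: the midpoint of x and y has energy at least m *)
    have "(1/2) *\<^sub>R (x + y) \<in> V" using V(1) that by (simp add: subspace_add subspace_scale)
    then have "m \<le> J ((1/2) *\<^sub>R (x + y))" by (rule m_le)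
    also have "J ((1/2) *\<^sub>R (x + y)) = (norm (x + y))\<^sup>2 / 4 - (f x + f y)"
    proof -
      have e1: "f ((1/2) *\<^sub>R (x + y)) = (f x + f y) / 2"
        using that scale[of "x + y" "1/2"] add[of x y] V(1) by (simp add: subspace_add del: scaleR_right_distrib)
      have e2: "(norm ((1/2) *\<^sub>R (x + y)))\<^sup>2 = (norm (x + y))\<^sup>2 / 4"
        unfolding norm_scaleR by (simp add: power_divide)
      show ?thesis unfolding J_def e1 e2 by (simp add: field_simps)
    qed
    finally show ?thesis
      unfolding J_def by (simp add: power2_norm_eq_inner algebra_simps inner_commute)
  qed
  have "Cauchy v"
  proof (rule metric_CauchyI)
    fix e :: real assume e: "e > 0"
    then obtain N where N: "1 / real (Suc N) < e\<^sup>2 / 4"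
      using reals_Archimedean[of "e\<^sup>2/4"] by (auto simp: inverse_eq_divide)
    have "dist (v i) (v j) < e" if "i \<ge> N" "j \<ge> N" for i j
    proof -
      have *: "J (v k) - m < e\<^sup>2 / 4" if "k \<ge> N" for k
      proof -
        have "1 / real (Suc k) \<le> 1 / real (Suc N)" using that by (simp add: frac_le)
        then show ?thesis using v(2)[of k] N by linarith
      qed
      have "(norm (v i - v j))\<^sup>2 < e\<^sup>2"
        using par[OF v(1) v(1), of i j] *[OF that(1)] *[OF that(2)] by simp
      then show ?thesis using e by (simp add: dist_norm power2_less_imp_less)
    qed
    then show "\<exists>N. \<forall>i\<ge>N. \<forall>j\<ge>N. dist (v i) (v j) < e" by blast
  qed
  then obtain u where u: "v \<longlonglongrightarrow> u" using Cauchy_convergent_iff convergent_def by blast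
  have uV: "u \<in> V" using V(2) u v(1) closed_sequentially by blast
  have "(\<lambda>k. f (v k)) \<longlonglongrightarrow> f u"
  proof -
    have "(\<lambda>k. f (v k) - f u) \<longlonglongrightarrow> 0"
    proof (rule Lim_null_comparison[of _ "\<lambda>k. K * norm (v k - u)"])
      have d: "f (v k - u) = f (v k) - f u" for k
        using add[of "v k" "(-1) *\<^sub>R u"] scale[of u "-1"] v(1) uV V(1) by (simp add: subspace_neg)
      show "\<forall>\<^sub>F k in sequentially. norm (f (v k) - f u) \<le> K * norm (v k - u)"
        using bound v(1) uV V(1) by (simp flip: d add: subspace_diff)
      show "(\<lambda>k. K * norm (v k - u)) \<longlonglongrightarrow> 0"
        using tendsto_mult_right_zero[OF tendsto_norm_zero[OF LIM_zero[OF u]]] by simp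
    qed
    then show ?thesis by (rule LIM_zero_cancel)
  qed
  then have lim: "(\<lambda>k. J (v k)) \<longlonglongrightarrow> J u" unfolding J_def by (intro tendsto_intros u)
  have lim': "(\<lambda>k. m + 1 / real (Suc k)) \<longlonglongrightarrow> m + 0"
    by (intro tendsto_intros LIMSEQ_Suc lim_1_over_n)
  have "J u \<le> m + 0"
    by (rule LIMSEQ_le[OF lim lim']) (use v(2) less_imp_le in blast)
  then have Ju: "J u \<le> J w" if "w \<in> V" for w using m_le[OF that] by simp
  have "inner u w = f w" if w: "w \<in> V" for w
  proof -
    define d where "d = inner u w - f w"
    have q: "0 \<le> 2 * t * d + t\<^sup>2 * (norm w)\<^sup>2" for t
    proof -
      have "u + t *\<^sub>R w \<in> V" using V(1) uV w by (simp add: subspace_add subspace_scale)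
      then have "J u \<le> J (u + t *\<^sub>R w)" by (rule Ju)
      also have "J (u + t *\<^sub>R w) = J u + 2 * t * d + t\<^sup>2 * (norm w)\<^sup>2"
      proof -
        have "f (u + t *\<^sub>R w) = f u + t * f w"
          using add[OF uV, of "t *\<^sub>R w"] scale[OF w] V(1) w by (simp add: subspace_scale)
        moreover have "(norm (u + t *\<^sub>R w))\<^sup>2 = (norm u)\<^sup>2 + 2 * t * inner u w + t\<^sup>2 * (norm w)\<^sup>2"
          unfolding power2_norm_eq_inner
          by (simp add: inner_add_left inner_add_right inner_commute power2_eq_square)
        ultimately show ?thesis unfolding J_def d_def by (simp add: algebra_simps)
      qed
      finally show ?thesis by simp
    qed
    have "d = 0" by (rule quadratic_nonneg_imp_linear_coeff_0[OF _ q]) simp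
    then show ?thesis by (simp add: d_def)
  qed
  then show ?thesis using uV by blast
qed

lemma orth_proj_eqI:
  assumes "subspace V" "p \<in> V" "\<And>v. v \<in> V \<Longrightarrow> inner (x - p) v = 0"
  shows "orth_proj V x = p"
  unfolding orth_proj_def
proof (rule the_equality)
  show "p \<in> V \<and> (\<forall>v\<in>V. inner (x - p) v = 0)" using assms by blast
  fix p' assume p': "p' \<in> V \<and> (\<forall>v\<in>V. inner (x - p') v = 0)"
  then have "p' - p \<in> V" using assms by (simp add: subspace_diff)
  then have "inner (x - p) (p' - p) - inner (x - p') (p' - p) = 0" using assms p' by simp
  then have "inner (p' - p) (p' - p) = 0" by (simp flip: inner_diff_left)
  then show "p' = p" by simp
qed

lemma
  fixes V :: "'a::{real_inner, complete_space} set"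
  assumes V: "subspace V" "closed V"
  shows orth_proj_in: "orth_proj V x \<in> V"
    and orth_proj_orthogonal: "v \<in> V \<Longrightarrow> inner (x - orth_proj V x) v = 0"
proof -
  obtain p where "p \<in> V" "\<forall>v\<in>V. inner p v = inner x v"
    using riesz_representation_closed_subspace[OF V, of "inner x" "norm x"]
    by (auto simp: inner_add_right Cauchy_Schwarz_ineq2)
  then have *: "p \<in> V \<and> (\<forall>v\<in>V. inner (x - p) v = 0)" by (simp add: inner_diff_left)
  moreover have "orth_proj V x = p" using * orth_proj_eqI[OF V(1)] by blast
  ultimately show "orth_proj V x \<in> V" "v \<in> V \<Longrightarrow> inner (x - orth_proj V x) v = 0" by auto
qed

lemma bounded_linear_orth_proj:
  fixes V :: "'a::{real_inner, complete_space} set"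
  assumes V: "subspace V" "closed V"
  shows "bounded_linear (orth_proj V)"
proof (rule bounded_linear_intro[where K=1])
  note p = orth_proj_in[OF V] orth_proj_orthogonal[OF V]
  fix x y :: 'a and r :: real
  show "orth_proj V (x + y) = orth_proj V x + orth_proj V y"
    using p(1)[of x] p(1)[of y] p(2)[of _ x] p(2)[of _ y] V
    by (intro orth_proj_eqI) (auto simp: subspace_add add_diff_add inner_add_left)
  show "orth_proj V (r *\<^sub>R x) = r *\<^sub>R orth_proj V x"
    using p(1)[of x] p(2)[of _ x] V
    by (intro orth_proj_eqI) (auto simp: subspace_scale simp flip: scaleR_diff_right)
  have "(norm (orth_proj V x))\<^sup>2 = inner x (orth_proj V x)"
    using p(2)[OF p(1), of x x] by (simp add: inner_diff_left power2_norm_eq_inner)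
  also have "\<dots> \<le> norm x * norm (orth_proj V x)" by (rule norm_cauchy_schwarz)
  finally show "norm (orth_proj V x) \<le> norm x * 1"
    by (cases "norm (orth_proj V x) = 0") (auto simp: power2_eq_square)
qed

lemma subspace_closure:
  fixes S :: "'a::real_normed_vector set"
  assumes "subspace S"
  shows "subspace (closure S)"
  unfolding subspace_def
proof (intro conjI ballI allI)
  show "0 \<in> closure S" using assms closure_subset subspace_0 by blast
  fix x assume "x \<in> closure S"
  then obtain f where f: "\<And>n. f n \<in> S" "f \<longlonglongrightarrow> x" unfolding closure_sequential by blast
  fix r :: real
  have "(\<lambda>n. r *\<^sub>R f n) \<longlonglongrightarrow> r *\<^sub>R x" by (intro tendsto_intros f)
  then show "r *\<^sub>R x \<in> closure S"
    unfolding closure_sequential using f(1) assms by (auto intro!: exI[of _ "\<lambda>n. r *\<^sub>R f n"] subspace_scale)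
  fix y assume "y \<in> closure S"
  then obtain g where g: "\<And>n. g n \<in> S" "g \<longlonglongrightarrow> y" unfolding closure_sequential by blast
  have "(\<lambda>n. f n + g n) \<longlonglongrightarrow> x + y" by (intro tendsto_intros f g)
  then show "x + y \<in> closure S"
    unfolding closure_sequential using f(1) g(1) assms by (auto intro!: exI[of _ "\<lambda>n. f n + g n"] subspace_add)
qed

text \<open>
  The form in which the projection theorem serves to prove density: a closed subspace without a normal
  unit vector is the whole space.
\<close>

lemma orthogonal_comp_proper_closed_subspace:
  fixes V :: "'a::{real_inner, complete_space} set"
  assumes V: "subspace V" "closed V" and ne: "V \<noteq> UNIV"
  obtains z where "norm z = 1" "\<And>v. v \<in> V \<Longrightarrow> inner z v = 0"
proof -
  obtain x where x: "x \<notin> V" using ne by blast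
  define y where "y = x - orth_proj V x"
  have "y \<noteq> 0" using orth_proj_in[OF V, of x] x by (auto simp: y_def)
  moreover have "inner y v = 0" if "v \<in> V" for v
    unfolding y_def by (rule orth_proj_orthogonal[OF V that])
  ultimately show ?thesis by (intro that[of "y /\<^sub>R norm y"]) auto
qed

section \<open>Orthonormal systems and traces\<close>

definition orthonormal :: "'a::real_inner set \<Rightarrow> bool" where
  "orthonormal B \<longleftrightarrow> pairwise orthogonal B \<and> (\<forall>e\<in>B. norm e = 1)"

lemma orthonormal_insert:
  assumes "orthonormal B" "norm z = 1" "\<And>b. b \<in> B \<Longrightarrow> inner z b = 0"
  shows "orthonormal (insert z B)"
  using assms by (auto simp: orthonormal_def pairwise_insert orthogonal_def inner_commute)

lemma orthonormal_independent: "orthonormal B \<Longrightarrow> independent B"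
  by (rule pairwise_orthogonal_independent) (auto simp: orthonormal_def)

lemma orthonormal_inner_sum:
  assumes "orthonormal F" "finite F" "e \<in> F"
  shows "inner (\<Sum>b\<in>F. g b *\<^sub>R b) e = g e"
proof -
  have "inner (\<Sum>b\<in>F. g b *\<^sub>R b) e = (\<Sum>b\<in>F. if b = e then g b else 0)"
    unfolding inner_sum_left
    using assms by (intro sum.cong) (auto simp: orthonormal_def pairwise_def orthogonal_def norm_eq_1)
  then show ?thesis using assms by simp
qed

lemma Bessel_inequality:
  assumes F: "orthonormal F" "finite F"
  shows "(\<Sum>e\<in>F. (inner e x)\<^sup>2) \<le> (norm x)\<^sup>2"
proof -
  define p where "p = (\<Sum>e\<in>F. inner e x *\<^sub>R e)"
  have "inner p x = (\<Sum>e\<in>F. (inner e x)\<^sup>2)"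
    by (simp add: p_def inner_sum_left power2_eq_square)
  moreover have "inner p p = (\<Sum>e\<in>F. (inner e x)\<^sup>2)"
    using orthonormal_inner_sum[OF F, of _ "\<lambda>e. inner e x"]
    unfolding p_def[symmetric]
    by (subst (2) p_def) (simp add: inner_sum_right power2_eq_square)
  moreover have "0 \<le> inner (x - p) (x - p)" by simp
  ultimately show ?thesis
    by (simp add: inner_diff_left inner_diff_right inner_commute power2_norm_eq_inner)
qed

text \<open>
  Bessel's inequality for both vectors, combined by the Cauchy-Schwarz inequality over \<open>F\<close>. It bounds
  the trace of the rank-one operator \<open>x \<mapsto> \<langle>a,x\<rangle> b\<close> over any orthonormal system.
\<close>

lemma Bessel_bilinear:
  assumes F: "orthonormal F" "finite F"
  shows "(\<Sum>e\<in>F. \<bar>inner a e * inner b e\<bar>) \<le> norm a * norm b"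
proof -
  have "L2_set (\<lambda>e. inner x e) F \<le> norm x" for x
    unfolding L2_set_def using Bessel_inequality[OF F, of x]
    by (intro real_le_lsqrt) (auto simp: inner_commute sum_nonneg)
  then have "L2_set (\<lambda>e. inner a e) F * L2_set (\<lambda>e. inner b e) F \<le> norm a * norm b"
    by (intro mult_mono) auto
  then show ?thesis
    using L2_set_mult_ineq[of "inner a" "inner b" F] by (simp add: abs_mult)
qed

text \<open>
  A maximal orthonormal set, given by Zorn's lemma, has dense span: otherwise a unit vector normal to the
  closure of the span could be added to it.
\<close>

lemma orthonormal_basis_exists:
  "\<exists>B :: 'a::{real_inner, complete_space} set. orthonormal_basis B"
proof -
  have "\<exists>M\<in>{B :: 'a set. orthonormal B}. \<forall>X\<in>{B. orthonormal B}. M \<subseteq> X \<longrightarrow> X = M"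
  proof (rule subset_Zorn_nonempty)
    show "{B :: 'a set. orthonormal B} \<noteq> {}" by (auto simp: orthonormal_def intro!: exI[of _ "{}"])
    fix \<C> :: "'a set set" assume "\<C> \<noteq> {}" and "subset.chain {B. orthonormal B} \<C>"
    then have c: "\<And>B. B \<in> \<C> \<Longrightarrow> orthonormal B" "\<And>A B. A \<in> \<C> \<Longrightarrow> B \<in> \<C> \<Longrightarrow> A \<subseteq> B \<or> B \<subseteq> A"
      by (auto simp: subset_chain_def)
    have "orthogonal x y" if "x \<in> \<Union>\<C>" "y \<in> \<Union>\<C>" "x \<noteq> y" for x y
    proof -
      from that obtain A B where "A \<in> \<C>" "B \<in> \<C>" "x \<in> A" "y \<in> B" by blast
      then obtain C where "C \<in> \<C>" "x \<in> C" "y \<in> C" using c(2)[of A B] by blast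
      then show ?thesis using c(1)[of C] that(3) by (auto simp: orthonormal_def pairwise_def)
    qed
    then show "\<Union>\<C> \<in> {B. orthonormal B}"
      using c(1) by (auto simp: orthonormal_def pairwise_def)
  qed
  then obtain B :: "'a set" where B: "orthonormal B" and max: "\<And>X. orthonormal X \<Longrightarrow> B \<subseteq> X \<Longrightarrow> X = B"
    by auto
  have "closure (span B) = UNIV"
  proof (rule ccontr)
    assume "closure (span B) \<noteq> UNIV"
    then obtain z where z: "norm z = 1" "\<And>v. v \<in> closure (span B) \<Longrightarrow> inner z v = 0"
      using orthogonal_comp_proper_closed_subspace[of "closure (span B)"]
      by (metis closed_closure subspace_closure subspace_span)
    have z': "inner z b = 0" if "b \<in> B" for b
      using z(2)[OF subsetD[OF closure_subset span_base[OF that]]] .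
    then have "insert z B = B" by (intro max orthonormal_insert B z(1) z') auto
    then have "inner z z = 0" using z' by blast
    then show False using z(1) by simp
  qed
  then show ?thesis using B unfolding orthonormal_basis_def orthonormal_def by blast
qed

text \<open>
  Partial traces of a nuclear operator are bounded uniformly in the orthonormal system. This makes the
  trace of a nonnegative nuclear operator summable, and it also limits the number of orthonormal
  eigenvectors for a positive eigenvalue.
\<close>

lemma nuclear_Bessel_bound:
  assumes "nuclear T"
  obtains K where "\<And>F. orthonormal F \<Longrightarrow> finite F \<Longrightarrow> (\<Sum>e\<in>F. inner (T e) e) \<le> K"
proof -
  obtain a b :: "nat \<Rightarrow> 'a" where ab: "summable (\<lambda>i. norm (a i) * norm (b i))"
    "\<And>x. (\<lambda>i. inner (a i) x *\<^sub>R b i) sums T x"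
    using assms unfolding nuclear_def by blast
  show ?thesis
  proof (rule that)
    fix F :: "'a set" assume F: "orthonormal F" "finite F"
    have "(\<lambda>i. inner (inner (a i) e *\<^sub>R b i) e) sums inner (T e) e" for e
      by (rule bounded_linear.sums[OF bounded_linear_inner_left ab(2)])
    then have s: "(\<lambda>i. \<Sum>e\<in>F. inner (a i) e * inner (b i) e) sums (\<Sum>e\<in>F. inner (T e) e)"
      by (intro sums_sum) simp
    have "(\<Sum>e\<in>F. inner (a i) e * inner (b i) e) \<le> norm (a i) * norm (b i)" for i
      by (rule order_trans[OF sum_mono Bessel_bilinear[OF F]]) auto
    then show "(\<Sum>e\<in>F. inner (T e) e) \<le> (\<Sum>i. norm (a i) * norm (b i))"
      using sums_le[OF _ s summable_sums[OF ab(1)]] by blast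
  qed
qed

text \<open>
  For a nonnegative form, a null vector is orthogonal to everything. This is the first-order condition
  for the minimum \<open>0\<close> of \<open>t \<mapsto> \<langle>T(x + t Tx), x + t Tx\<rangle>\<close> at \<open>t = 0\<close>.
\<close>

lemma self_adjoint_nonneg_null:
  assumes T: "bounded_linear T" "self_adjoint T" "nonnegative_op T" and "inner (T x) x = 0"
  shows "T x = 0"
proof -
  interpret bounded_linear T by fact
  define y where "y = T x"
  have q: "0 \<le> 2 * t * inner y y + t\<^sup>2 * inner (T y) y" for t
  proof -
    have "0 \<le> inner (T (x + t *\<^sub>R y)) (x + t *\<^sub>R y)" using T(3) by (simp add: nonnegative_op_def)
    also have "\<dots> = 2 * t * inner y y + t\<^sup>2 * inner (T y) y"
      using assms(4) T(2) unfolding self_adjoint_def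
      by (simp add: add scaleR inner_add_left inner_add_right power2_eq_square algebra_simps y_def inner_commute)
    finally show ?thesis .
  qed
  have "inner y y = 0"
    by (rule quadratic_nonneg_imp_linear_coeff_0[OF _ q]) (use T(3) in \<open>simp add: nonnegative_op_def\<close>)
  then show ?thesis by (simp add: y_def)
qed

text \<open>
  If all diagonal entries in an orthonormal basis vanished, \<open>T\<close> would vanish on the basis by
  \<open>self_adjoint_nonneg_null\<close>, and hence everywhere by continuity. Summability matters as well: the
  value of a divergent sum is \<open>0\<close> by convention.
\<close>

lemma op_trace_pos:
  fixes T :: "'a::{real_inner, complete_space} \<Rightarrow> 'a"
  assumes T: "bounded_linear T" "self_adjoint T" "nonnegative_op T" "nuclear T" and nz: "T \<noteq> (\<lambda>x. 0)"
  shows "op_trace T > 0"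
proof -
  define B :: "'a set" where "B = (SOME B. orthonormal_basis B)"
  have B: "orthonormal_basis B"
    unfolding B_def by (rule someI_ex[OF orthonormal_basis_exists])
  then have on: "orthonormal F" if "F \<subseteq> B" for F
    using that unfolding orthonormal_basis_def orthonormal_def by (meson pairwise_subset subsetD)
  have nn: "0 \<le> inner (T e) e" for e using T(3) by (simp add: nonnegative_op_def)
  obtain K where K: "\<And>F. orthonormal F \<Longrightarrow> finite F \<Longrightarrow> (\<Sum>e\<in>F. inner (T e) e) \<le> K"
    using nuclear_Bessel_bound[OF T(4)] by blast
  have "(\<lambda>e. inner (T e) e) summable_on B"
    using on K nn by (intro nonneg_bdd_above_summable_on bdd_aboveI) auto
  moreover have "\<exists>e\<in>B. inner (T e) e \<noteq> 0"
  proof (rule ccontr)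
    assume "\<not> ?thesis"
    then have "T e = 0" if "e \<in> B" for e using self_adjoint_nonneg_null[OF T(1,2,3)] that by blast
    then have "T x = 0" if "x \<in> span B" for x
      using linear_eq_0_on_span[OF bounded_linear.linear[OF T(1)]] that by blast
    moreover have "closed {x. T x = 0}"
      by (intro closed_Collect_eq continuous_intros linear_continuous_on T)
    ultimately have "closure (span B) \<subseteq> {x. T x = 0}" by (intro closure_minimal) auto
    then have "T x = 0" for x using B unfolding orthonormal_basis_def by auto
    then show False using nz by blast
  qed
  then obtain e where "e \<in> B" "0 < inner (T e) e" using nn by (metis less_eq_real_def)
  ultimately show ?thesis
    unfolding op_trace_def B_def[symmetric]
    using infsum_mono_neutral[of "\<lambda>e. inner (T e) e" "{e}" "\<lambda>e. inner (T e) e" B] nn by auto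
qed

section \<open>The largest eigenvalue of a nonnegative nuclear operator\<close>

text \<open>
  The partial sums of the nuclear expansion map the unit ball into compact sums of segments, and the
  tail of the expansion is uniformly small on the ball. So the image is totally bounded.
\<close>

lemma nuclear_compact_image_cball:
  fixes T :: "'a::{real_inner, complete_space} \<Rightarrow> 'a"
  assumes "nuclear T"
  shows "compact (closure (T ` cball 0 1))"
proof -
  obtain a b :: "nat \<Rightarrow> 'a" where ab: "summable (\<lambda>i. norm (a i) * norm (b i))"
    "\<And>x. (\<lambda>i. inner (a i) x *\<^sub>R b i) sums T x"
    using assms unfolding nuclear_def by blast
  have "\<exists>k. finite k \<and> closure (T ` cball 0 1) \<subseteq> (\<Union>x\<in>k. ball x \<epsilon>)" if \<epsilon>: "\<epsilon> > 0" for \<epsilon> :: real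
  proof -
    obtain N where N: "norm (\<Sum>i. norm (a (i + N)) * norm (b (i + N))) < \<epsilon> / 4"
      using suminf_exist_split[OF _ ab(1), of "\<epsilon> / 4"] \<epsilon> by auto
    (* K n contains the image of the unit ball under the n-th partial sum: a sum of n segments *)
    define K where "K = rec_nat {0} (\<lambda>n S. {x + y | x y. x \<in> S \<and> y \<in> (\<lambda>t. t *\<^sub>R b n) ` {- norm (a n) .. norm (a n)}})"
    have K0: "K 0 = {0}"
      and KS: "K (Suc n) = {x + y | x y. x \<in> K n \<and> y \<in> (\<lambda>t. t *\<^sub>R b n) ` {- norm (a n) .. norm (a n)}}" for n
      by (simp_all add: K_def)
    have cK: "compact (K n)" for n
    proof (induction n)
      case (Suc n)
      show ?case unfolding KS
        by (intro compact_sums Suc compact_continuous_image continuous_intros) simp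
    qed (simp add: K0)
    have inK: "(\<Sum>i<n. inner (a i) x *\<^sub>R b i) \<in> K n" if "norm x \<le> 1" for n x
    proof (induction n)
      case (Suc n)
      have "\<bar>inner (a n) x\<bar> \<le> norm (a n) * norm x" by (rule Cauchy_Schwarz_ineq2)
      also have "\<dots> \<le> norm (a n)" using that by (simp add: mult_left_le)
      finally show ?case using Suc unfolding KS by (fastforce simp: abs_le_iff)
    qed (simp add: K0)
    have tail: "dist (\<Sum>i<N. inner (a i) x *\<^sub>R b i) (T x) \<le> \<epsilon> / 4" if "norm x \<le> 1" for x
    proof -
      have s: "summable (\<lambda>i. norm (a (i + N)) * norm (b (i + N)))"
        using ab(1) by (rule summable_ignore_initial_segment)
      have le: "norm (inner (a i) x *\<^sub>R b i) \<le> norm (a i) * norm (b i)" for i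
      proof -
        have "\<bar>inner (a i) x\<bar> \<le> norm (a i) * norm x" by (rule Cauchy_Schwarz_ineq2)
        also have "\<dots> \<le> norm (a i)" using that by (simp add: mult_left_le)
        finally show ?thesis by (simp add: mult_right_mono)
      qed
      have "(\<lambda>i. inner (a (i + N)) x *\<^sub>R b (i + N)) sums (T x - (\<Sum>i<N. inner (a i) x *\<^sub>R b i))"
        by (rule sums_split_initial_segment[OF ab(2)])
      moreover have "norm (\<Sum>i<m. inner (a (i + N)) x *\<^sub>R b (i + N)) \<le> (\<Sum>i. norm (a (i + N)) * norm (b (i + N)))" for m
        by (rule order_trans[OF sum_norm_le[OF le] sum_le_suminf[OF s]]) auto
      ultimately have "norm (T x - (\<Sum>i<N. inner (a i) x *\<^sub>R b i)) \<le> (\<Sum>i. norm (a (i + N)) * norm (b (i + N)))"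
        unfolding sums_def by (intro LIMSEQ_le_const2[OF tendsto_norm]) auto
      then show ?thesis using N by (simp add: dist_norm norm_minus_commute)
    qed
    obtain k where k: "finite k" "K N \<subseteq> (\<Union>x\<in>k. ball x (\<epsilon> / 4))"
      using cK[of N] \<epsilon> unfolding compact_eq_totally_bounded by (metis divide_pos_pos zero_less_numeral)
    have "T ` cball 0 1 \<subseteq> (\<Union>x\<in>k. cball x (\<epsilon> / 2))"
    proof
      fix y assume "y \<in> T ` cball 0 1"
      then obtain x where x: "norm x \<le> 1" "y = T x" by auto
      then obtain z where z: "z \<in> k" "dist z (\<Sum>i<N. inner (a i) x *\<^sub>R b i) < \<epsilon> / 4"
        using inK[OF x(1), of N] k(2) by auto
      have "dist z y \<le> \<epsilon> / 2"
        using dist_triangle[of z y "\<Sum>i<N. inner (a i) x *\<^sub>R b i"] z(2) tail[OF x(1)] x(2) by simp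
      then show "y \<in> (\<Union>x\<in>k. cball x (\<epsilon> / 2))" using z(1) by auto
    qed
    then have "closure (T ` cball 0 1) \<subseteq> (\<Union>x\<in>k. cball x (\<epsilon> / 2))"
      using k(1) by (intro closure_minimal closed_UN) auto
    also have "\<dots> \<subseteq> (\<Union>x\<in>k. ball x \<epsilon>)" using \<epsilon> by force
    finally show ?thesis using k(1) by blast
  qed
  then show ?thesis
    unfolding compact_eq_totally_bounded by (simp add: complete_eq_closed)
qed

text \<open>
  Choose unit vectors \<open>x\<^sub>k\<close> with \<open>\<parallel>T x\<^sub>k\<parallel> \<rightarrow> l = \<parallel>T\<parallel>\<close>. Expanding the square gives
  \<open>\<parallel>T\<^sup>2 x\<^sub>k - l\<^sup>2 x\<^sub>k\<parallel>\<^sup>2 \<le> l\<^sup>2 (l\<^sup>2 - \<parallel>T x\<^sub>k\<parallel>\<^sup>2) \<rightarrow> 0\<close>. By compactness a subsequence of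
  \<open>T x\<^sub>k\<close> converges, hence so does \<open>x\<^sub>k\<close> itself, to a unit vector \<open>x\<close> with \<open>(T - l)(T + l) x = 0\<close>.
  Nonnegativity of \<open>T\<close> ensures \<open>(T + l) x \<noteq> 0\<close>.
\<close>

lemma onorm_is_eigenvalue:
  fixes T :: "'a::{real_inner, complete_space} \<Rightarrow> 'a"
  assumes T: "bounded_linear T" "self_adjoint T" "nonnegative_op T"
    and cpt: "compact (closure (T ` cball 0 1))" and nz: "T \<noteq> (\<lambda>x. 0)"
  shows "\<exists>z. z \<noteq> 0 \<and> T z = onorm T *\<^sub>R z"
proof -
  interpret bounded_linear T by fact
  define l where "l = onorm T"
  have l: "l > 0" unfolding l_def using onorm_pos_lt[OF T(1)] nz by auto
  have "\<exists>x. norm x = 1 \<and> norm (T x) > l - 1 / real (Suc k)" for k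
  proof -
    (* truncation at 0, since an upper bound for the operator norm has to be nonnegative *)
    define b where "b = max 0 (l - 1 / real (Suc k))"
    have "b < l" using l by (simp add: b_def)
    then have "\<not> (\<forall>x. norm (T x) \<le> b * norm x)"
      using onorm_bound[of b T] unfolding l_def b_def by (meson max.cobounded1 not_le)
    then obtain x where x: "norm (T x) > b * norm x" by (auto simp: not_le)
    then have "x \<noteq> 0" using zero by auto
    then have "norm (T (x /\<^sub>R norm x)) > b" using x by (simp add: scaleR field_simps)
    then show ?thesis
      using \<open>x \<noteq> 0\<close> by (intro exI[of _ "x /\<^sub>R norm x"]) (auto simp: b_def)
  qed
  then obtain x where x: "\<And>k. norm (x k) = 1" "\<And>k. norm (T (x k)) > l - 1 / real (Suc k)" by metis
  have "\<forall>k. T (x k) \<in> closure (T ` cball 0 1)"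
    using x(1) closure_subset[of "T ` cball 0 1"] by auto
  then obtain y r where r: "strict_mono r" and y: "((\<lambda>k. T (x k)) \<circ> r) \<longlonglongrightarrow> y"
    using cpt unfolding compact_eq_seq_compact_metric seq_compact_def by metis
  define u where "u k = x (r k)" for k
  have u1: "norm (u k) = 1" for k by (simp add: u_def x)
  have Tu: "(\<lambda>k. T (u k)) \<longlonglongrightarrow> y" using y by (simp add: u_def o_def)
  have Tul: "(\<lambda>k. norm (T (u k))) \<longlonglongrightarrow> l"
  proof (rule tendsto_sandwich)
    show "\<forall>\<^sub>F k in sequentially. l - 1 / real (Suc (r k)) \<le> norm (T (u k))"
      using x(2) by (simp add: u_def less_imp_le)
    show "\<forall>\<^sub>F k in sequentially. norm (T (u k)) \<le> l"
      using onorm[OF T(1)] u1 by (metis (mono_tags, lifting) always_eventually l_def mult.right_neutral)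
    have "(\<lambda>k. 1 / real (Suc (r k))) \<longlonglongrightarrow> 0"
      using LIMSEQ_subseq_LIMSEQ[OF LIMSEQ_Suc[OF lim_1_over_n] r] by (simp add: o_def)
    then show "(\<lambda>k. l - 1 / real (Suc (r k))) \<longlonglongrightarrow> l"
      using tendsto_diff[OF tendsto_const, of "\<lambda>k. 1 / real (Suc (r k))" 0 sequentially l] by simp
  qed simp
  have "(\<lambda>k. T (T (u k)) - l\<^sup>2 *\<^sub>R u k) \<longlonglongrightarrow> 0"
  proof (rule Lim_null_comparison)
    show "\<forall>\<^sub>F k in sequentially. norm (T (T (u k)) - l\<^sup>2 *\<^sub>R u k) \<le> l * sqrt (l\<^sup>2 - (norm (T (u k)))\<^sup>2)"
    proof (intro always_eventually allI)
      fix k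
      have "norm (T (u k)) \<le> l" using onorm[OF T(1), of "u k"] u1 by (simp add: l_def)
      then have nn: "0 \<le> l\<^sup>2 - (norm (T (u k)))\<^sup>2" by (simp add: power_mono)
      have "norm (T (T (u k))) \<le> l * norm (T (u k))" using onorm[OF T(1)] by (simp add: l_def)
      then have TT: "(norm (T (T (u k))))\<^sup>2 \<le> l\<^sup>2 * (norm (T (u k)))\<^sup>2"
        by (metis norm_ge_zero power_mono power_mult_distrib)
      have in1: "inner (T (T (u k))) (u k) = (norm (T (u k)))\<^sup>2"
        using T(2) by (simp add: self_adjoint_def power2_norm_eq_inner)
      have "(norm (T (T (u k)) - l\<^sup>2 *\<^sub>R u k))\<^sup>2
          = (norm (T (T (u k))))\<^sup>2 - 2 * l\<^sup>2 * inner (T (T (u k))) (u k) + (l\<^sup>2)\<^sup>2 * (norm (u k))\<^sup>2"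
        unfolding power2_norm_eq_inner
        by (simp add: inner_diff_left inner_diff_right inner_commute algebra_simps power2_eq_square)
      also have "\<dots> \<le> l\<^sup>2 * (l\<^sup>2 - (norm (T (u k)))\<^sup>2)"
        using TT unfolding in1 u1 by (simp add: algebra_simps power2_eq_square)
      finally have "norm (T (T (u k)) - l\<^sup>2 *\<^sub>R u k) \<le> sqrt (l\<^sup>2 * (l\<^sup>2 - (norm (T (u k)))\<^sup>2))"
        by (rule real_le_rsqrt)
      then show "norm (T (T (u k)) - l\<^sup>2 *\<^sub>R u k) \<le> l * sqrt (l\<^sup>2 - (norm (T (u k)))\<^sup>2)"
        using l by (simp add: real_sqrt_mult)
    qed
    have "(\<lambda>k. l * sqrt (l\<^sup>2 - (norm (T (u k)))\<^sup>2)) \<longlonglongrightarrow> l * sqrt (l\<^sup>2 - l\<^sup>2)"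
      by (intro tendsto_intros Tul)
    then show "(\<lambda>k. l * sqrt (l\<^sup>2 - (norm (T (u k)))\<^sup>2)) \<longlonglongrightarrow> 0" by simp
  qed
  moreover have TTu: "(\<lambda>k. T (T (u k))) \<longlonglongrightarrow> T y" by (rule tendsto[OF Tu])
  ultimately have "(\<lambda>k. T (T (u k)) - (T (T (u k)) - l\<^sup>2 *\<^sub>R u k)) \<longlonglongrightarrow> T y - 0"
    by (intro tendsto_diff)
  then have lu: "(\<lambda>k. l\<^sup>2 *\<^sub>R u k) \<longlonglongrightarrow> T y" by simp
  define w where "w = T y /\<^sub>R l\<^sup>2"
  have "(\<lambda>k. (l\<^sup>2 *\<^sub>R u k) /\<^sub>R l\<^sup>2) \<longlonglongrightarrow> w" unfolding w_def by (intro tendsto_intros lu)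
  then have uw: "u \<longlonglongrightarrow> w" using l by simp
  have w1: "norm w = 1"
    using LIMSEQ_unique[OF tendsto_norm[OF uw]] u1 by simp
  have "y = T w" using LIMSEQ_unique[OF Tu tendsto[OF uw]] .
  then have TTw: "T (T w) = l\<^sup>2 *\<^sub>R w" using l by (simp add: w_def)
  define z where "z = T w + l *\<^sub>R w"
  have "inner z w = inner (T w) w + l" using w1 by (simp add: z_def inner_add_left norm_eq_1)
  then have "inner z w > 0" using l T(3) by (simp add: nonnegative_op_def add_nonneg_pos)
  then have "z \<noteq> 0" by auto
  moreover have "T z = l *\<^sub>R z" by (simp add: z_def add scaleR TTw algebra_simps power2_eq_square)
  ultimately show ?thesis unfolding l_def by blast
qed

text \<open>
  An orthonormal set of \<open>m\<close> eigenvectors contributes \<open>m l\<close> to a partial trace, so \<open>m\<close> is bounded by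
  \<open>nuclear_Bessel_bound\<close>. A set of maximal size spans the eigenspace, by one Gram-Schmidt step.
\<close>

lemma nuclear_eigenspace_orthonormal_basis:
  fixes T :: "'a::real_inner \<Rightarrow> 'a"
  assumes T: "bounded_linear T" "nuclear T" and l: "l > 0"
  obtains F where "finite F" "orthonormal F" "span F = {x. T x = l *\<^sub>R x}"
proof -
  interpret bounded_linear T by fact
  define E where "E = {x. T x = l *\<^sub>R x}"
  have E: "subspace E" unfolding E_def subspace_def by (auto simp: add scaleR algebra_simps)
  obtain K where K: "\<And>F. orthonormal F \<Longrightarrow> finite F \<Longrightarrow> (\<Sum>e\<in>F. inner (T e) e) \<le> K"
    using nuclear_Bessel_bound[OF T(2)] by blast
  define P where "P F \<longleftrightarrow> finite F \<and> orthonormal F \<and> F \<subseteq> E" for F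
  have card: "card F < Suc (nat \<lfloor>K / l\<rfloor>)" if "P F" for F
  proof -
    have "(\<Sum>e\<in>F. inner (T e) e) = (\<Sum>e\<in>F. l)"
      using that by (intro sum.cong) (auto simp: P_def E_def orthonormal_def norm_eq_1)
    then have "real (card F) * l \<le> K" using K[of F] that by (simp add: P_def)
    then have "real (card F) \<le> K / l" using l by (simp add: field_simps)
    then show ?thesis by (simp add: le_nat_floor less_Suc_eq_le)
  qed
  have "P {}" by (simp add: P_def orthonormal_def)
  then obtain F where F: "P F" and max: "\<And>G. P G \<Longrightarrow> card G \<le> card F"
    using ex_has_greatest_nat[of P "{}" card] card less_imp_le_nat by metis
  have "x \<in> span F" if x: "x \<in> E" for x
  proof (rule ccontr)
    assume nx: "x \<notin> span F"
    define p where "p = (\<Sum>e\<in>F. inner x e *\<^sub>R e)"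
    have p: "p \<in> span F" unfolding p_def by (intro span_sum span_scale span_base)
    have "span F \<subseteq> E" using F E by (intro span_minimal) (auto simp: P_def)
    then have xp: "x - p \<in> E" using p x E by (auto intro: subspace_diff)
    have "x - p \<noteq> 0" using nx p by auto
    define z where "z = (x - p) /\<^sub>R norm (x - p)"
    have orth: "inner z e = 0" if "e \<in> F" for e
      using orthonormal_inner_sum[of F e "inner x"] that F
      by (simp add: z_def P_def inner_diff_left p_def)
    have z: "norm z = 1" "z \<in> E" using \<open>x - p \<noteq> 0\<close> xp E by (auto simp: z_def subspace_scale)
    then have "z \<notin> F" using orth[of z] by (auto simp: norm_eq_1)
    moreover have "P (insert z F)" using F z orth by (auto simp: P_def intro: orthonormal_insert)
    ultimately show False using max[of "insert z F"] F by (simp add: P_def)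
  qed
  moreover have "span F \<subseteq> E" using F E by (intro span_minimal) (auto simp: P_def)
  ultimately have "span F = E" by blast
  then show ?thesis using that[of F] F by (simp add: P_def E_def)
qed

section \<open>Injective operators with closed range\<close>

text \<open>
  Let \<open>A x\<^sub>n \<rightarrow> A y\<close> with \<open>\<parallel>x\<^sub>n\<parallel> \<le> k\<close>. For the vectors z of the range of the adjoint,
  \<open>\<langle>z, x\<^sub>n\<rangle> \<rightarrow> \<langle>z, y\<rangle>\<close> and therefore \<open>\<bar>\<langle>z, y\<rangle>\<bar> \<le> k \<parallel>z\<parallel>\<close>. These vectors are dense because A is
  injective, so the bound holds for all z, and \<open>z = y\<close> gives \<open>\<parallel>y\<parallel> \<le> k\<close>.
\<close>

lemma closed_image_cball:
  fixes A :: "'g::{real_inner, complete_space} \<Rightarrow> 'h::{real_inner, complete_space}"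
  assumes A: "bounded_linear A" "inj A" and cl: "closed (range A)"
  shows "closed (A ` cball 0 k)"
  unfolding closed_sequential_limits
proof (intro allI impI, elim conjE)
  interpret bounded_linear A by fact
  fix s u assume s: "\<forall>n. s n \<in> A ` cball 0 k" and su: "s \<longlonglongrightarrow> u"
  then obtain x where x: "\<And>n. norm (x n) \<le> k" "\<And>n. s n = A (x n)"
    unfolding image_iff by (metis mem_cball_0)
  have "u \<in> range A" using closed_sequentially[OF cl _ su] x by auto
  then obtain y where y: "u = A y" by blast
  (* D is the range of the adjoint of A *)
  define D where "D = {z. \<exists>w. \<forall>x. inner z x = inner w (A x)}"
  have D: "subspace D"
    unfolding subspace_def
  proof (intro conjI ballI allI)
    show "0 \<in> D" unfolding D_def by (auto intro: exI[of _ 0])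
    fix z assume "z \<in> D"
    then obtain w where w: "\<And>x. inner z x = inner w (A x)" by (auto simp: D_def)
    fix r :: real
    have "inner (r *\<^sub>R z) x = inner (r *\<^sub>R w) (A x)" for x by (simp add: w)
    then show "r *\<^sub>R z \<in> D" unfolding D_def by blast
    fix z' assume "z' \<in> D"
    then obtain w' where w': "\<And>x. inner z' x = inner w' (A x)" by (auto simp: D_def)
    have "inner (z + z') x = inner (w + w') (A x)" for x by (simp add: w w' inner_add_left)
    then show "z + z' \<in> D" unfolding D_def by blast
  qed
  have "closure D = UNIV"
  proof (rule ccontr)
    assume "closure D \<noteq> UNIV"
    then obtain z where z: "norm z = 1" "\<And>v. v \<in> closure D \<Longrightarrow> inner z v = 0"
      using orthogonal_comp_proper_closed_subspace[OF subspace_closure[OF D]] by blast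
    obtain K where K: "\<And>v. norm (A v) \<le> norm v * K" using bounded by blast
    have "\<exists>v\<in>UNIV. \<forall>x\<in>UNIV. inner v x = inner (A z) (A x)"
    proof (rule riesz_representation_closed_subspace[where K = "norm (A z) * K"])
      fix v
      have "\<bar>inner (A z) (A v)\<bar> \<le> norm (A z) * norm (A v)" by (rule Cauchy_Schwarz_ineq2)
      also have "\<dots> \<le> norm (A z) * (norm v * K)" by (intro mult_left_mono K) simp
      finally show "\<bar>inner (A z) (A v)\<bar> \<le> norm (A z) * K * norm v" by (simp add: ac_simps)
    qed (auto simp: add scaleR inner_add_right)
    then obtain v where v: "\<And>x. inner v x = inner (A z) (A x)" by blast
    then have "v \<in> D" by (auto simp: D_def)
    then have "v \<in> closure D" using closure_subset by blast
    then have "inner (A z) (A z) = 0" using z(2) v by (metis inner_commute)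
    then have "z = 0" using A(2) zero by (simp add: inj_eq[of A z 0, symmetric])
    then show False using z(1) by simp
  qed
  have "\<bar>inner z y\<bar> \<le> k * norm z" if "z \<in> D" for z
  proof -
    from that obtain w where w: "\<And>x. inner z x = inner w (A x)" by (auto simp: D_def)
    have "(\<lambda>n. inner w (s n)) \<longlonglongrightarrow> inner w u" by (intro tendsto_intros su)
    then have "(\<lambda>n. inner z (x n)) \<longlonglongrightarrow> inner z y"
      by (simp add: w x(2) y)
    then have "(\<lambda>n. \<bar>inner z (x n)\<bar>) \<longlonglongrightarrow> \<bar>inner z y\<bar>" by (rule tendsto_rabs)
    moreover have "\<bar>inner z (x n)\<bar> \<le> k * norm z" for n
    proof -
      have "\<bar>inner z (x n)\<bar> \<le> norm z * norm (x n)" by (rule Cauchy_Schwarz_ineq2)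
      also have "\<dots> \<le> norm z * k" by (intro mult_left_mono x) simp
      finally show ?thesis by (simp add: mult.commute)
    qed
    ultimately show ?thesis by (intro LIMSEQ_le_const2) auto
  qed
  then have "closure D \<subseteq> {z. \<bar>inner z y\<bar> \<le> k * norm z}"
    by (intro closure_minimal closed_Collect_le continuous_intros) auto
  then have "y \<in> {z. \<bar>inner z y\<bar> \<le> k * norm z}" using \<open>closure D = UNIV\<close> by blast
  then have "\<bar>inner y y\<bar> \<le> k * norm y" by simp
  moreover have "0 \<le> k" using order_trans[OF norm_ge_zero x(1)] .
  ultimately have "norm y \<le> k" 
    by (cases "norm y = 0") (auto simp: power2_norm_eq_inner[symmetric] power2_eq_square)
  then show "u \<in> A ` cball 0 k" using y by auto
qed

text \<open>
  The bounded inverse theorem. The complete space \<open>range A\<close> is the union of the sets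
  \<open>A({\<parallel>x\<parallel> \<le> k})\<close>, which are closed by \<open>closed_image_cball\<close>. By Baire's theorem one of them
  has an interior point. As it is closed, this set itself contains a ball
  of the range, and shifting and scaling this ball gives the bound.
\<close>

lemma closed_range_imp_bounded_below:
  fixes A :: "'g::{real_inner, complete_space} \<Rightarrow> 'h::{real_inner, complete_space}"
  assumes A: "bounded_linear A" "inj A" and cl: "closed (range A)"
  obtains C where "\<And>x. norm x \<le> C * norm (A x)"
proof -
  interpret bounded_linear A by fact
  let ?X = "top_of_set (range A)"
  have X: "completely_metrizable_space ?X"
    using cl by (intro completely_metrizable_space_closedin completely_metrizable_space_euclidean) simp
  define \<G> where "\<G> = range (\<lambda>k::nat. A ` cball 0 (real k))"
  have "\<Union>\<G> = range A"
  proof -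
    have "A x \<in> A ` cball 0 (real (nat \<lceil>norm x\<rceil>))" for x by (intro imageI) (simp add: real_nat_ceiling_ge)
    then show ?thesis unfolding \<G>_def by blast
  qed
  then have "?X interior_of \<Union>\<G> \<noteq> {}"
    using interior_of_topspace[of ?X] by auto
  moreover have "?X interior_of \<Union>\<G> = {}" if "\<And>T. T \<in> \<G> \<Longrightarrow> ?X interior_of T = {}"
    using X that
    by (intro Baire_category_alt)
       (auto simp: \<G>_def closedin_closed_eq[OF cl] intro!: closed_image_cball A cl closed_subset)
  ultimately obtain k :: nat where k: "?X interior_of (A ` cball 0 (real k)) \<noteq> {}"
    by (auto simp: \<G>_def)
  then obtain u where u: "u \<in> ?X interior_of (A ` cball 0 (real k))" by blast
  then obtain S where S: "open S" "u \<in> S" "range A \<inter> S \<subseteq> A ` cball 0 (real k)" "u \<in> range A"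
    unfolding interior_of_def openin_open by auto
  then obtain e where e: "e > 0" "ball u e \<subseteq> S" by (meson openE)
  have sub: "v \<in> A ` cball 0 (real k)" if "v \<in> range A" "dist u v < e" for v
    using that subsetD[OF e(2), of v] subsetD[OF S(3), of v] by simp
  obtain x0 where x0: "u = A x0" "norm x0 \<le> real k" using sub[OF S(4)] e by auto
  show ?thesis
  proof (rule that)
    fix x show "norm x \<le> (4 * real k / e) * norm (A x)"
    proof (cases "A x = 0")
      case True
      then have "x = 0" using A(2) zero by (simp add: inj_eq[of A x 0, symmetric])
      then show ?thesis using zero by simp
    next
      case False
      (* scaling A x to length e / 2 keeps the point u + t A x within distance e of u *)
      define t where "t = e / (2 * norm (A x))"
      have t: "t > 0" using e False by (simp add: t_def)
      have "u + t *\<^sub>R A x = A (x0 + t *\<^sub>R x)" by (simp add: x0 add scaleR)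
      then have "u + t *\<^sub>R A x \<in> range A" by simp
      moreover have "dist u (u + t *\<^sub>R A x) < e"
        using e False by (simp add: dist_norm t_def)
      ultimately have "u + t *\<^sub>R A x \<in> A ` cball 0 (real k)" by (rule sub)
      then obtain x1 where x1: "A (x0 + t *\<^sub>R x) = A x1" "norm x1 \<le> real k"
        by (auto simp: x0 add scaleR)
      then have "t *\<^sub>R x = x1 - x0" using A(2) by (auto simp: inj_eq)
      then have "t * norm x \<le> 2 * real k"
        using norm_triangle_ineq4[of x1 x0] x0(2) x1(2) t by (metis abs_of_pos add_mono mult_2 norm_scaleR order_trans)
      then show ?thesis using e False by (simp add: t_def field_simps)
    qed
  qed
qed

text \<open>
  The functional \<open>u \<mapsto> \<langle>c, A\<inverse> u\<rangle>\<close> is bounded on the range of \<open>A\<close>, so it has a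
  representing vector there.
\<close>

lemma adjoint_on_inverse:
  fixes A :: "'g::{real_inner, complete_space} \<Rightarrow> 'h::{real_inner, complete_space}"
  assumes A: "bounded_linear A" "inj A" and cl: "closed (range A)"
  shows "adjoint_on (range A) (inv A) c \<in> range A"
    and "inner (adjoint_on (range A) (inv A) c) (A x) = inner c x"
proof -
  interpret bounded_linear A by fact
  obtain C where C: "\<And>x. norm x \<le> C * norm (A x)"
    using closed_range_imp_bounded_below[OF A cl] by blast
  have sub: "subspace (range A)" using linear_subspace_image[OF linear_axioms subspace_UNIV] .
  have "\<exists>u\<in>range A. \<forall>v\<in>range A. inner u v = inner c (inv A v)"
  proof (rule riesz_representation_closed_subspace[OF sub cl, where K = "norm c * C"])
    fix v w assume "v \<in> range A" "w \<in> range A"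
    then obtain x y where v: "v = A x" "w = A y" by blast
    have "inv A (A x + A y) = x + y" using A(2) by (simp flip: add)
    then show "inner c (inv A (v + w)) = inner c (inv A v) + inner c (inv A w)"
      using A(2) v by (simp add: inner_add_right)
  next
    fix v t assume "v \<in> range A"
    then obtain x where v: "v = A x" by blast
    have "inv A (t *\<^sub>R A x) = t *\<^sub>R x" using A(2) by (simp flip: scaleR)
    then show "inner c (inv A (t *\<^sub>R v)) = t * inner c (inv A v)" using A(2) v by simp
  next
    fix v assume "v \<in> range A"
    then obtain x where v: "v = A x" by blast
    have "\<bar>inner c x\<bar> \<le> norm c * norm x" by (rule Cauchy_Schwarz_ineq2)
    also have "\<dots> \<le> norm c * (C * norm (A x))" by (intro mult_left_mono C) simp
    finally show "\<bar>inner c (inv A v)\<bar> \<le> norm c * C * norm v" using A(2) v by (simp add: ac_simps)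
  qed
  then obtain u where u: "u \<in> range A" "\<And>v. v \<in> range A \<Longrightarrow> inner u v = inner c (inv A v)" by blast
  have "adjoint_on (range A) (inv A) c = u"
    unfolding adjoint_on_def
  proof (rule the_equality)
    fix u' assume u': "u' \<in> range A \<and> (\<forall>w\<in>range A. inner u' w = inner c (inv A w))"
    then have "u' - u \<in> range A" using u sub by (simp add: subspace_diff)
    then have "inner u' (u' - u) = inner u (u' - u)" using u(2) u' by metis
    then have "inner (u' - u) (u' - u) = 0" by (simp add: inner_diff_left)
    then show "u' = u" by simp
  qed (use u in blast)
  then show "adjoint_on (range A) (inv A) c \<in> range A"
    and "inner (adjoint_on (range A) (inv A) c) (A x) = inner c x"
    using u A(2) by auto
qed

section \<open>Independence from a factorizing characteristic function\<close>

text \<open>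
  Weighting the measure by a bounded positive density \<open>g\<close> that is uncorrelated with every
  \<open>exp (i s X)\<close> does not change the characteristic function of \<open>X\<close>. By Levy's uniqueness theorem it does
  not change the law of \<open>X\<close> either, so \<open>g\<close> is uncorrelated with every event \<open>X \<in> B\<close>.
\<close>

lemma (in prob_space) char_factor_imp_event_factor_real:
  fixes X G :: "'a \<Rightarrow> real"
  assumes X[measurable]: "random_variable borel X" and G[measurable]: "random_variable borel G"
    and bd: "\<And>\<omega>. \<bar>G \<omega>\<bar> \<le> K"
    and fac: "\<And>s. (CLINT \<omega>|M. iexp (s * X \<omega>) * complex_of_real (G \<omega>))
                = (CLINT \<omega>|M. iexp (s * X \<omega>)) * complex_of_real (expectation G)"
    and B[measurable]: "B \<in> sets borel"
  shows "expectation (\<lambda>\<omega>. indicator B (X \<omega>) * G \<omega>) = prob (X -` B \<inter> space M) * expectation G"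
proof -
  (* the shift makes the weight at least 1, hence positive; dividing by its mean c normalizes it *)
  define g where "g \<omega> = G \<omega> + (K + 1)" for \<omega>
  have gm[measurable]: "random_variable borel g" by (simp add: g_def[abs_def])
  have g1: "g \<omega> \<ge> 1" for \<omega> using bd[of \<omega>] by (simp add: g_def)
  have iG: "integrable M G" by (rule integrable_const_bound[where B=K]) (use bd in auto)
  have ig: "integrable M g" using iG by (simp add: g_def[abs_def])
  define c where "c = expectation g"
  have c_eq: "c = expectation G + (K + 1)" using iG by (simp add: c_def g_def[abs_def] prob_space)
  have c1: "c \<ge> 1" unfolding c_def by (rule integral_ge_const[OF ig]) (use g1 in auto)
  have g0: "0 \<le> g \<omega> / c" for \<omega> using g1[of \<omega>] c1 by simp
  define D where "D = density M (\<lambda>\<omega>. ennreal (g \<omega> / c))"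
  have "emeasure D (space D) = ennreal (expectation (\<lambda>\<omega>. g \<omega> / c))"
    unfolding D_def using ig g0
    by (simp add: emeasure_density space_density cong: nn_integral_cong_simp) (subst nn_integral_eq_integral, auto)
  also have "\<dots> = 1" using c1 by (simp add: c_def)
  finally have D: "prob_space D" by (intro prob_spaceI)
  have XD: "X \<in> borel_measurable D" by (simp add: D_def)
  have "char (distr D borel X) = char (distr M borel X)"
  proof
    fix s
    have i0: "integrable M (\<lambda>\<omega>. iexp (s * X \<omega>))"
      by (rule integrable_const_bound[where B=1]) auto
    have i1: "integrable M (\<lambda>\<omega>. iexp (s * X \<omega>) * complex_of_real (G \<omega>))"
      by (rule integrable_const_bound[where B=K]) (use bd in \<open>auto simp: norm_mult\<close>)
    have "char (distr D borel X) s = (CLINT \<omega>|D. iexp (s * X \<omega>))"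
      unfolding char_def by (rule integral_distr[OF XD]) simp
    also have "\<dots> = (CLINT \<omega>|M. (g \<omega> / c) *\<^sub>R iexp (s * X \<omega>))"
      unfolding D_def by (rule integral_density) (use g0 in auto)
    also have "\<dots> = (CLINT \<omega>|M. (iexp (s * X \<omega>) * complex_of_real (G \<omega>) + (K + 1) *\<^sub>R iexp (s * X \<omega>)) / c)"
      by (intro Bochner_Integration.integral_cong) (auto simp: g_def scaleR_conv_of_real field_simps)
    also have "\<dots> = ((CLINT \<omega>|M. iexp (s * X \<omega>) * complex_of_real (G \<omega>)) + (K + 1) *\<^sub>R (CLINT \<omega>|M. iexp (s * X \<omega>))) / c"
      using i0 i1 by simp
    also have "\<dots> = (CLINT \<omega>|M. iexp (s * X \<omega>))"
    proof -
      have "(CLINT \<omega>|M. iexp (s * X \<omega>)) * complex_of_real (expectation G) + (K + 1) *\<^sub>R (CLINT \<omega>|M. iexp (s * X \<omega>))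
          = (CLINT \<omega>|M. iexp (s * X \<omega>)) * complex_of_real c"
        unfolding c_eq by (simp add: scaleR_conv_of_real algebra_simps)
      then show ?thesis unfolding fac using c1 by simp
    qed
    also have "\<dots> = char (distr M borel X) s"
      unfolding char_def by (rule integral_distr[symmetric, OF X]) simp
    finally show "char (distr D borel X) s = char (distr M borel X) s" .
  qed
  moreover have "real_distribution (distr D borel X)" "real_distribution (distr M borel X)"
    using prob_space.real_distribution_distr[OF D XD] real_distribution_distr[OF X] by auto
  ultimately have eq: "distr D borel X = distr M borel X" by (intro Levy_uniqueness)
  have iB: "integrable M (\<lambda>\<omega>. indicator B (X \<omega>) * G \<omega>)"
    by (rule integrable_const_bound[where B=K]) (use bd in \<open>auto simp: indicator_def intro: order_trans[OF abs_ge_zero]\<close>)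
  have iB': "integrable M (\<lambda>\<omega>. indicator B (X \<omega>) :: real)"
    by (rule integrable_const_bound[where B=1]) auto
  have pB: "(\<integral>\<omega>. (indicator B (X \<omega>) :: real) \<partial>M) = prob (X -` B \<inter> space M)"
  proof -
    have "(\<integral>\<omega>. (indicator B (X \<omega>) :: real) \<partial>M) = (\<integral>\<omega>. (indicator (X -` B \<inter> space M) \<omega> :: real) \<partial>M)"
      by (intro Bochner_Integration.integral_cong) (auto simp: indicator_def)
    then show ?thesis by simp
  qed
  have "(\<integral>\<omega>. indicator B (X \<omega>) * g \<omega> \<partial>M) / c = (\<integral>\<omega>. (g \<omega> / c) *\<^sub>R indicator B (X \<omega>) \<partial>M)"
    by (simp add: mult.commute)
  also have "\<dots> = (\<integral>\<omega>. indicator B (X \<omega>) \<partial>D)"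
    unfolding D_def by (rule integral_density[symmetric]) (use g0 in auto)
  also have "\<dots> = (\<integral>x. indicator B x \<partial>distr D borel X)"
    by (rule integral_distr[symmetric, OF XD]) simp
  also have "\<dots> = (\<integral>\<omega>. indicator B (X \<omega>) \<partial>M)"
    unfolding eq by (rule integral_distr[OF X]) simp
  finally have "(\<integral>\<omega>. indicator B (X \<omega>) * g \<omega> \<partial>M) = prob (X -` B \<inter> space M) * c"
    using c1 pB by (simp add: field_simps)
  moreover have "(\<integral>\<omega>. indicator B (X \<omega>) * g \<omega> \<partial>M)
      = (\<integral>\<omega>. indicator B (X \<omega>) * G \<omega> \<partial>M) + (\<integral>\<omega>. indicator B (X \<omega>) \<partial>M) * (K + 1)"
    using iB iB' by (simp add: g_def distrib_left)
  ultimately show ?thesis using pB by (simp add: c_eq algebra_simps)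
qed

text \<open>
  The real and the imaginary part of \<open>G\<close> both inherit the hypothesis. For this the complex conjugate of
  \<open>G\<close> has to satisfy it, which follows by passing from \<open>s\<close> to \<open>-s\<close>.
\<close>

lemma (in prob_space) char_factor_imp_event_factor:
  fixes X :: "'a \<Rightarrow> real" and G :: "'a \<Rightarrow> complex"
  assumes X[measurable]: "random_variable borel X" and G[measurable]: "random_variable borel G"
    and bd: "\<And>\<omega>. norm (G \<omega>) \<le> K"
    and fac: "\<And>s. (CLINT \<omega>|M. iexp (s * X \<omega>) * G \<omega>) = (CLINT \<omega>|M. iexp (s * X \<omega>)) * (CLINT \<omega>|M. G \<omega>)"
    and B[measurable]: "B \<in> sets borel"
  shows "(CLINT \<omega>|M. indicator B (X \<omega>) * G \<omega>) = of_real (prob (X -` B \<inter> space M)) * (CLINT \<omega>|M. G \<omega>)"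
proof -
  define \<phi> where "\<phi> s = (CLINT \<omega>|M. iexp (s * X \<omega>))" for s
  have iG: "integrable M G" by (rule integrable_const_bound[where B=K]) (use bd in auto)
  have [measurable]: "random_variable borel (\<lambda>\<omega>. cnj (G \<omega>))"
    by (rule measurable_compose[OF G]) (intro borel_measurable_continuous_onI continuous_intros)
  have ie: "integrable M (\<lambda>\<omega>. iexp (s * X \<omega>) * G \<omega>)" for s
    by (rule integrable_const_bound[where B=K]) (use bd in \<open>auto simp: norm_mult\<close>)
  have ie': "integrable M (\<lambda>\<omega>. iexp (s * X \<omega>) * cnj (G \<omega>))" for s
    by (rule integrable_const_bound[where B=K]) (use bd in \<open>auto simp: norm_mult\<close>)
  have cn: "cnj (iexp x) = iexp (- x)" for x by (simp add: exp_cnj)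
  have facc: "(CLINT \<omega>|M. iexp (s * X \<omega>) * cnj (G \<omega>)) = \<phi> s * cnj (CLINT \<omega>|M. G \<omega>)" for s
  proof -
    have "(CLINT \<omega>|M. iexp (s * X \<omega>) * cnj (G \<omega>)) = (CLINT \<omega>|M. cnj (iexp ((- s) * X \<omega>) * G \<omega>))"
      unfolding complex_cnj_mult cn by simp
    also have "\<dots> = cnj (\<phi> (- s) * (CLINT \<omega>|M. G \<omega>))"
      unfolding \<phi>_def fac[symmetric] by (rule Bochner_Integration.integral_cnj)
    also have "cnj (\<phi> (- s)) = \<phi> s"
      unfolding \<phi>_def Bochner_Integration.integral_cnj[symmetric] cn by simp
    then have "cnj (\<phi> (- s) * (CLINT \<omega>|M. G \<omega>)) = \<phi> s * cnj (CLINT \<omega>|M. G \<omega>)" by simp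
    finally show ?thesis .
  qed
  have Re_eq: "complex_of_real (Re z) = (z + cnj z) / 2" for z by (simp add: complex_add_cnj)
  have Im_eq: "complex_of_real (Im z) = (z - cnj z) / (2 * \<i>)" for z
    unfolding complex_diff_cnj by (simp add: field_simps)
  have "expectation (\<lambda>\<omega>. indicator B (X \<omega>) * Re (G \<omega>)) = prob (X -` B \<inter> space M) * expectation (\<lambda>\<omega>. Re (G \<omega>))"
  proof (rule char_factor_imp_event_factor_real[OF X])
    fix s
    have "(CLINT \<omega>|M. iexp (s * X \<omega>) * complex_of_real (Re (G \<omega>)))
        = (CLINT \<omega>|M. (iexp (s * X \<omega>) * G \<omega> + iexp (s * X \<omega>) * cnj (G \<omega>)) / 2)"
      unfolding Re_eq by (simp add: algebra_simps)
    also have "\<dots> = ((CLINT \<omega>|M. iexp (s * X \<omega>) * G \<omega>) + (CLINT \<omega>|M. iexp (s * X \<omega>) * cnj (G \<omega>))) / 2"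
      using ie[of s] ie'[of s] by simp
    also have "\<dots> = (\<phi> s * (CLINT \<omega>|M. G \<omega>) + \<phi> s * cnj (CLINT \<omega>|M. G \<omega>)) / 2"
      unfolding fac facc \<phi>_def ..
    also have "\<dots> = \<phi> s * complex_of_real (Re (CLINT \<omega>|M. G \<omega>))"
      unfolding Re_eq by (simp add: algebra_simps)
    finally show "(CLINT \<omega>|M. iexp (s * X \<omega>) * complex_of_real (Re (G \<omega>)))
        = (CLINT \<omega>|M. iexp (s * X \<omega>)) * complex_of_real (expectation (\<lambda>\<omega>. Re (G \<omega>)))"
      using iG by (simp add: \<phi>_def)
  qed (use bd abs_Re_le_cmod order_trans in \<open>auto, blast\<close>)
  moreover have "expectation (\<lambda>\<omega>. indicator B (X \<omega>) * Im (G \<omega>)) = prob (X -` B \<inter> space M) * expectation (\<lambda>\<omega>. Im (G \<omega>))"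
  proof (rule char_factor_imp_event_factor_real[OF X])
    fix s
    have "(CLINT \<omega>|M. iexp (s * X \<omega>) * complex_of_real (Im (G \<omega>)))
        = (CLINT \<omega>|M. (iexp (s * X \<omega>) * G \<omega> - iexp (s * X \<omega>) * cnj (G \<omega>)) / (2 * \<i>))"
      unfolding Im_eq by (simp add: algebra_simps)
    also have "\<dots> = ((CLINT \<omega>|M. iexp (s * X \<omega>) * G \<omega>) - (CLINT \<omega>|M. iexp (s * X \<omega>) * cnj (G \<omega>))) / (2 * \<i>)"
      using ie[of s] ie'[of s] by simp
    also have "\<dots> = (\<phi> s * (CLINT \<omega>|M. G \<omega>) - \<phi> s * cnj (CLINT \<omega>|M. G \<omega>)) / (2 * \<i>)"
      unfolding fac facc \<phi>_def ..
    also have "\<dots> = \<phi> s * complex_of_real (Im (CLINT \<omega>|M. G \<omega>))"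
      unfolding Im_eq by (simp add: algebra_simps)
    finally show "(CLINT \<omega>|M. iexp (s * X \<omega>) * complex_of_real (Im (G \<omega>)))
        = (CLINT \<omega>|M. iexp (s * X \<omega>)) * complex_of_real (expectation (\<lambda>\<omega>. Im (G \<omega>)))"
      using iG by (simp add: \<phi>_def)
  qed (use bd abs_Im_le_cmod order_trans in \<open>auto, blast\<close>)
  moreover have iB: "integrable M (\<lambda>\<omega>. indicator B (X \<omega>) * G \<omega>)"
    by (rule integrable_const_bound[where B=K])
       (use bd in \<open>auto simp: norm_mult indicator_def intro: order_trans[OF norm_ge_zero]\<close>)
  moreover have "Re (indicator B x * z) = indicator B x * Re z" "Im (indicator B x * z) = indicator B x * Im z"
    for x :: real and z by (auto simp: indicator_def)
  ultimately show ?thesis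
    using iG by (intro complex_eqI) (simp_all flip: integral_Re integral_Im)
qed

text \<open>
  Kac's theorem, obtained from one-dimensional uniqueness alone. In the expectation of
  \<open>\<Prod>\<^sub>i exp (i t\<^sub>i X\<^sub>i)\<close> the factors \<open>exp (i t\<^sub>j X\<^sub>j)\<close> are replaced by indicators of events
  \<open>X\<^sub>j \<in> B\<^sub>j\<close>, one variable at a time. When \<open>X\<^sub>j\<close> is replaced, the product of the other factors is
  the complex weight \<open>G\<close> of \<open>char_factor_imp_event_factor\<close>.
\<close>

lemma (in prob_space) indep_vars_of_char_factor:
  fixes X :: "'i \<Rightarrow> 'a \<Rightarrow> real"
  assumes I: "finite I" and X: "\<And>i. i \<in> I \<Longrightarrow> random_variable borel (X i)"
    and fac: "\<And>t. (CLINT \<omega>|M. iexp (\<Sum>i\<in>I. t i * X i \<omega>)) = (\<Prod>i\<in>I. char (distr M borel (X i)) (t i))"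
  shows "indep_vars (\<lambda>_. borel) X I"
proof -
  let ?\<phi> = "\<lambda>i. char (distr M borel (X i))"
  have \<phi>: "?\<phi> i s = (CLINT \<omega>|M. iexp (s * X i \<omega>))" if "i \<in> I" for i s
    unfolding char_def by (rule integral_distr[OF X[OF that]]) simp
  have mixed: "(CLINT \<omega>|M. (\<Prod>i\<in>J. indicator (B i) (X i \<omega>)) * iexp (\<Sum>i\<in>I - J. t i * X i \<omega>))
      = (\<Prod>i\<in>J. complex_of_real (prob (X i -` B i \<inter> space M))) * (\<Prod>i\<in>I - J. ?\<phi> i (t i))"
    if "finite J" "J \<subseteq> I" "\<And>i. i \<in> J \<Longrightarrow> B i \<in> sets borel" for J B t
    using that
  proof (induction J arbitrary: t rule: finite_induct)
    case empty
    show ?case using fac[of t] by simp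
  next
    case (insert j J)
    have j: "j \<in> I" using insert.prems by simp
    define L where "L = I - insert j J"
    have L: "I - J = insert j L" "j \<notin> L" "finite L"
      using insert.hyps insert.prems I by (auto simp: L_def)
    define G :: "'a \<Rightarrow> complex" where "G \<omega> = (\<Prod>i\<in>J. indicator (B i) (X i \<omega>)) * iexp (\<Sum>i\<in>L. t i * X i \<omega>)" for \<omega>
    define C where "C = (\<Prod>i\<in>J. complex_of_real (prob (X i -` B i \<inter> space M))) * (\<Prod>i\<in>L. ?\<phi> i (t i))"
    have Xm[measurable]: "random_variable borel (X i)" if "i \<in> insert j (J \<union> L)" for i
      using X that insert.prems L by auto
    have Bm[measurable]: "B i \<in> sets borel" if "i \<in> insert j J" for i using insert.prems that by auto
    have Gm[measurable]: "random_variable borel G"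
      unfolding G_def[abs_def]
      by (intro borel_measurable_times borel_measurable_prod measurable_compose[OF Xm borel_measurable_indicator])
         (auto intro!: borel_measurable_sum Xm borel_measurable_exp Bm)
    have step: "(CLINT \<omega>|M. iexp (s * X j \<omega>) * G \<omega>) = ?\<phi> j s * C" for s
    proof -
      have eq: "iexp (\<Sum>i\<in>I - J. (t(j := s)) i * X i \<omega>) = iexp (s * X j \<omega>) * iexp (\<Sum>i\<in>L. t i * X i \<omega>)" for \<omega>
      proof -
        have "(\<Sum>i\<in>L. (t(j := s)) i * X i \<omega>) = (\<Sum>i\<in>L. t i * X i \<omega>)"
          using L(2) by (intro sum.cong) auto
        then show ?thesis using L by (simp add: exp_add[symmetric] distrib_left)
      qed
      have "(\<Prod>i\<in>L. ?\<phi> i ((t(j := s)) i)) = (\<Prod>i\<in>L. ?\<phi> i (t i))"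
        using L(2) by (intro prod.cong) auto
      then have "(\<Prod>i\<in>I - J. ?\<phi> i ((t(j := s)) i)) = ?\<phi> j s * (\<Prod>i\<in>L. ?\<phi> i (t i))"
        using L by simp
      then show ?thesis
        using insert.IH[of "t(j := s)"] insert.prems unfolding eq G_def C_def by (simp add: ac_simps)
    qed
    (* at s = 0 the factor of X j is 1 *)
    have EG: "(CLINT \<omega>|M. G \<omega>) = C"
      using step[of 0] by (simp add: \<phi>[OF j] prob_space)
    have "(CLINT \<omega>|M. indicator (B j) (X j \<omega>) * G \<omega>) = of_real (prob (X j -` B j \<inter> space M)) * (CLINT \<omega>|M. G \<omega>)"
    proof (rule char_factor_imp_event_factor)
      show "norm (G \<omega>) \<le> 1" for \<omega>
        unfolding G_def norm_mult norm_exp_i_times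
        by (simp add: prod_norm[symmetric]) (intro prod_le_1, auto simp: indicator_def)
      show "(CLINT \<omega>|M. iexp (s * X j \<omega>) * G \<omega>) = (CLINT \<omega>|M. iexp (s * X j \<omega>)) * (CLINT \<omega>|M. G \<omega>)" for s
        unfolding step EG \<phi>[OF j] ..
    qed (auto intro: Xm Bm)
    then show ?case
      using insert.hyps unfolding EG by (simp add: G_def C_def L_def mult.assoc)
  qed
  show ?thesis
    unfolding indep_vars_def2
  proof (intro conjI ballI X indep_setsI)
    fix i assume "i \<in> I"
    then show "{X i -` A \<inter> space M |A. A \<in> sets borel} \<subseteq> events" using X by (auto intro: measurable_sets)
  next
    fix A J assume J: "J \<noteq> {}" "J \<subseteq> I" "finite J"
      and A: "\<forall>j\<in>J. A j \<in> {X j -` A \<inter> space M |A. A \<in> sets borel}"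
    then obtain B where B: "\<And>j. j \<in> J \<Longrightarrow> B j \<in> sets borel" "\<And>j. j \<in> J \<Longrightarrow> A j = X j -` B j \<inter> space M"
      by (simp add: Bex_def) metis
    have meas: "(\<Inter>j\<in>J. A j) \<in> events"
      using J B X by (intro sets.finite_INT) (auto intro: measurable_sets)
    have "(\<Prod>i\<in>J. indicator (B i) (X i \<omega>)) = (indicator (\<Inter>j\<in>J. A j) \<omega> :: complex)" if "\<omega> \<in> space M" for \<omega>
    proof (cases "\<forall>j\<in>J. X j \<omega> \<in> B j")
      case False
      then have "(\<Prod>i\<in>J. indicator (B i) (X i \<omega>)) = (0 :: complex)"
        using J(3) by (intro prod_zero) (auto simp: indicator_def)
      then show ?thesis using False B(2) by (auto simp: indicator_def)
    qed (use that B in \<open>auto simp: indicator_def\<close>)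
    then have "(CLINT \<omega>|M. (\<Prod>i\<in>J. indicator (B i) (X i \<omega>))) = (CLINT \<omega>|M. indicator (\<Inter>j\<in>J. A j) \<omega>)"
      by (intro Bochner_Integration.integral_cong) auto
    also have "\<dots> = (CLINT \<omega>|M. complex_of_real (indicator (\<Inter>j\<in>J. A j) \<omega>))"
      by (simp add: of_real_indicator)
    also have "\<dots> = complex_of_real (prob (\<Inter>j\<in>J. A j))"
      unfolding integral_complex_of_real using meas by simp
    (* with t = 0 the variables outside J drop out *)
    finally have "complex_of_real (prob (\<Inter>j\<in>J. A j)) = (\<Prod>i\<in>J. complex_of_real (prob (X i -` B i \<inter> space M)))"
      using mixed[of J B "\<lambda>_. 0", OF J(3,2) B(1)] \<phi> by (simp add: prob_space)
    also have "\<dots> = complex_of_real (\<Prod>j\<in>J. prob (A j))"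
      using B(2) by (simp add: of_real_prod)
    finally show "prob (\<Inter>j\<in>J. A j) = (\<Prod>j\<in>J. prob (A j))" by (simp only: of_real_eq_iff)
  qed
qed

section \<open>Gaussian measures\<close>

lemma char_normal_law:
  assumes "v \<ge> 0"
  shows "char (normal_law \<mu> v) t = iexp (t * \<mu>) * exp (- (v * t\<^sup>2) / 2)"
proof (cases "v = 0")
  case True
  have "char (return borel \<mu>) t = iexp (t * \<mu>)"
    unfolding char_def by (subst integral_return) auto
  then show ?thesis using True by (simp add: normal_law_def)
next
  case False
  define N where "N = density lborel (\<lambda>x. ennreal (normal_density \<mu> (sqrt v) x))"
  have s: "sqrt v > 0" using False assms by simp
  interpret N: prob_space N unfolding N_def by (rule prob_space_normal_density[OF s])
  have "distributed N lborel (\<lambda>x. x) (normal_density \<mu> (sqrt v))"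
    unfolding distributed_def by (simp add: N_def distr_id2)
  then have "distributed N lborel (\<lambda>x. (x - \<mu>) / sqrt v) std_normal_density"
    using N.normal_standard_normal_convert[OF s] by simp
  then have d: "distr N lborel (\<lambda>x. (x - \<mu>) / sqrt v) = std_normal_distribution"
    by (simp add: distributed_def)
  have "char N t = (CLINT x|N. iexp (t * \<mu>) * iexp ((t * sqrt v) * ((x - \<mu>) / sqrt v)))"
    unfolding char_def using s
    by (intro Bochner_Integration.integral_cong) (auto simp: mult_exp_exp field_simps)
  also have "\<dots> = iexp (t * \<mu>) * (CLINT x|N. iexp ((t * sqrt v) * ((x - \<mu>) / sqrt v)))" by simp
  also have "(CLINT x|N. iexp ((t * sqrt v) * ((x - \<mu>) / sqrt v))) = char std_normal_distribution (t * sqrt v)"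
    unfolding char_def d[symmetric] by (rule integral_distr[symmetric]) (auto simp: N_def)
  finally show ?thesis
    using assms False by (simp add: normal_law_def N_def char_std_normal_distribution power_mult_distrib mult.commute)
qed

text \<open>
  A linear combination of the coordinates \<open>\<langle>a, \<cdot>\<rangle>\<close> is again a coordinate
  \<open>\<langle>b, \<cdot>\<rangle>\<close>, so the joint characteristic function is that of a one-dimensional
  marginal. Without correlations the variance of \<open>\<langle>b, \<cdot>\<rangle>\<close> is a sum over \<open>I\<close>, and the
  characteristic function factorizes.
\<close>

lemma gaussian_uncorrelated_imp_indep:
  fixes C :: "'a::real_inner \<Rightarrow> 'a"
  assumes M: "is_gaussian M \<xi> C" and C: "linear C" "nonnegative_op C" and I: "finite I"
    and uncor: "\<And>a b. a \<in> I \<Longrightarrow> b \<in> I \<Longrightarrow> a \<noteq> b \<Longrightarrow> inner (C a) b = 0"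
  shows "prob_space.indep_vars M (\<lambda>_. borel) inner I"
proof -
  interpret prob_space M using M by (simp add: is_gaussian_def)
  have "sets M = sets borel" using M by (simp add: is_gaussian_def)
  have m: "inner b \<in> borel_measurable M" for b
    unfolding measurable_cong_sets[OF \<open>sets M = sets borel\<close> refl]
    by (intro borel_measurable_continuous_onI continuous_intros)
  have ch: "char (distr M borel (inner b)) t = iexp (t * inner b \<xi>) * exp (- (inner (C b) b * t\<^sup>2) / 2)" for b t
    using M C(2) by (simp add: is_gaussian_def char_normal_law nonnegative_op_def)
  show ?thesis
  proof (rule indep_vars_of_char_factor[OF I m])
    fix t :: "'a \<Rightarrow> real"
    define b where "b = (\<Sum>a\<in>I. t a *\<^sub>R a)"
    have "inner (C b) b = (\<Sum>a\<in>I. \<Sum>a'\<in>I. t a * (t a' * inner (C a) a'))"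
      unfolding b_def linear_sum[OF C(1)] linear_scale[OF C(1)]
      by (simp add: inner_sum_left inner_sum_right sum_distrib_left) (subst sum.swap, simp add: mult.left_commute)
    also have "\<dots> = (\<Sum>a\<in>I. \<Sum>a'\<in>I. if a' = a then inner (C a) a * (t a)\<^sup>2 else 0)"
      using uncor by (intro sum.cong) (auto simp: power2_eq_square)
    finally have Cb: "inner (C b) b = (\<Sum>a\<in>I. inner (C a) a * (t a)\<^sup>2)" using I by simp
    have "(CLINT y|M. iexp (\<Sum>a\<in>I. t a * inner a y)) = (CLINT y|M. iexp (1 * inner b y))"
      by (simp add: b_def inner_sum_left)
    also have "\<dots> = char (distr M borel (inner b)) 1"
      unfolding char_def by (rule integral_distr[OF m, symmetric]) simp
    also have "\<dots> = exp (\<Sum>a\<in>I. \<i> * complex_of_real (t a * inner a \<xi>) + complex_of_real (- (inner (C a) a * (t a)\<^sup>2) / 2))"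
      unfolding ch Cb unfolding b_def
      by (simp add: inner_sum_left sum_subtractf mult_exp_exp sum_distrib_left sum_divide_distrib sum_negf exp_of_real[symmetric] of_real_sum)
    also have "\<dots> = (\<Prod>a\<in>I. char (distr M borel (inner a)) (t a))"
      unfolding exp_sum[OF I] ch exp_add by (simp flip: exp_of_real)
    finally show "(CLINT y|M. iexp (\<Sum>a\<in>I. t a * inner a y)) = (\<Prod>a\<in>I. char (distr M borel (inner a)) (t a))" .
  qed
qed

section \<open>The chi-square distribution\<close>

lemma nn_integral_Gamma_scaled:
  fixes a r :: real
  assumes a: "a > 0" and r: "r > 0"
  shows "(\<integral>\<^sup>+x. ennreal (indicator {0<..} x * (x powr (a - 1) * exp (- (r * x)))) \<partial>lborel)
       = ennreal (Gamma a / r powr a)" (is "?I = _")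
proof -
  have "ennreal (Gamma a) = (\<integral>\<^sup>+t. ennreal (indicator {0..} t * t powr (a - 1) / exp t) \<partial>lborel)"
    by (rule Gamma_conv_nn_integral_real[OF a])
  also have "\<dots> = ennreal \<bar>r\<bar> * (\<integral>\<^sup>+x. ennreal (indicator {0..} (0 + r * x) * (0 + r * x) powr (a - 1) / exp (0 + r * x)) \<partial>lborel)"
    by (rule nn_integral_real_affine) (use r in auto)
  also have "(\<integral>\<^sup>+x. ennreal (indicator {0..} (0 + r * x) * (0 + r * x) powr (a - 1) / exp (0 + r * x)) \<partial>lborel)
      = (\<integral>\<^sup>+x. ennreal (r powr (a - 1)) * ennreal (indicator {0<..} x * (x powr (a - 1) * exp (- (r * x)))) \<partial>lborel)"
    using r by (intro nn_integral_cong)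
      (auto simp: indicator_def powr_mult exp_minus zero_le_mult_iff ennreal_mult'[symmetric] field_simps)
  also have "\<dots> = ennreal (r powr (a - 1)) * ?I" by (rule nn_integral_cmult) simp
  finally have "ennreal (Gamma a) = ennreal (r * r powr (a - 1)) * ?I"
    using r by (simp add: ennreal_mult' mult.assoc)
  also have "r * r powr (a - 1) = r powr a" using r by (simp add: powr_mult_base)
  finally have "ennreal (Gamma a) = ennreal (r powr a) * ?I" .
  then have "ennreal (1 / r powr a) * ennreal (Gamma a) = ennreal (1 / r powr a * r powr a) * ?I"
    by (simp only: ennreal_mult' powr_ge_zero divide_nonneg_nonneg zero_le_one mult.assoc)
  then show ?thesis using r by (simp add: ennreal_mult'[symmetric])
qed

definition chi_square_density :: "real \<Rightarrow> real \<Rightarrow> real" where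
  "chi_square_density \<nu> x =
     indicator {0<..} x * (x powr (\<nu> / 2 - 1) * exp (- (1 / 2 * x))) / (2 powr (\<nu> / 2) * Gamma (\<nu> / 2))"

lemma chi_square_density_nonneg: "\<nu> > 0 \<Longrightarrow> 0 \<le> chi_square_density \<nu> x"
  by (simp add: chi_square_density_def Gamma_real_pos less_imp_le)

lemma chi_square_density_measurable[measurable]: "chi_square_density \<nu> \<in> borel_measurable borel"
  unfolding chi_square_density_def[abs_def] by measurable

lemma prob_space_chi_square:
  assumes "\<nu> > 0"
  shows "prob_space (density lborel (\<lambda>x. ennreal (chi_square_density \<nu> x)))"
proof
  let ?c = "1 / (2 powr (\<nu> / 2) * Gamma (\<nu> / 2))"
  have c: "?c \<ge> 0" using assms by (simp add: Gamma_real_pos less_imp_le)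
  have "(\<integral>\<^sup>+x. ennreal (chi_square_density \<nu> x) \<partial>lborel)
      = (\<integral>\<^sup>+x. ennreal ?c * ennreal (indicator {0<..} x * (x powr (\<nu> / 2 - 1) * exp (- (1 / 2 * x)))) \<partial>lborel)"
    by (intro nn_integral_cong) (auto simp: chi_square_density_def ennreal_mult'[OF c, symmetric])
  also have "\<dots> = ennreal ?c * ennreal (Gamma (\<nu> / 2) / (1 / 2) powr (\<nu> / 2))"
    using nn_integral_Gamma_scaled[of "\<nu> / 2" "1 / 2"] assms by (subst nn_integral_cmult) auto
  also have "\<dots> = 1"
    using assms less_imp_neq[OF Gamma_real_pos[of "\<nu> / 2"]]
    by (simp add: ennreal_mult'[OF c, symmetric] powr_divide)
  finally show "emeasure (density lborel (\<lambda>x. ennreal (chi_square_density \<nu> x)))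
      (space (density lborel (\<lambda>x. ennreal (chi_square_density \<nu> x)))) = 1"
    by (simp add: emeasure_density)
qed

text \<open>
  Substituting \<open>y = x t\<close> extracts the factor \<open>x powr ((\<mu> + \<nu>)/2 - 1) * exp (-x/2)\<close> and leaves a Beta
  integral over \<open>t \<in> [0,1]\<close>.
\<close>

lemma chi_square_convolution:
  assumes \<mu>: "\<mu> > 0" and \<nu>: "\<nu> > 0"
  shows "(\<integral>\<^sup>+y. ennreal (chi_square_density \<mu> (x - y)) * ennreal (chi_square_density \<nu> y) \<partial>lborel)
       = ennreal (chi_square_density (\<mu> + \<nu>) x)"
proof (cases "x > 0")
  case False
  then have "(\<integral>\<^sup>+y. ennreal (chi_square_density \<mu> (x - y)) * ennreal (chi_square_density \<nu> y) \<partial>lborel)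
      = (\<integral>\<^sup>+(y::real). 0 \<partial>lborel)"
    by (intro nn_integral_cong) (auto simp: chi_square_density_def indicator_def)
  then show ?thesis using False by (simp add: chi_square_density_def)
next
  case True
  define a b where "a = \<mu> / 2" and "b = \<nu> / 2"
  have ab: "a > 0" "b > 0" using \<mu> \<nu> by (simp_all add: a_def b_def)
  note G = Gamma_real_pos[OF ab(1)] Gamma_real_pos[OF ab(2)] Gamma_real_pos[OF add_pos_pos[OF ab]]
  define k where "k = x powr (a + b - 2) * exp (- (1 / 2 * x)) / (2 powr (a + b) * Gamma a * Gamma b)"
  have k: "k \<ge> 0" using G by (simp add: k_def)
  have "(\<integral>\<^sup>+y. ennreal (chi_square_density \<mu> (x - y)) * ennreal (chi_square_density \<nu> y) \<partial>lborel)
     = ennreal \<bar>x\<bar> * (\<integral>\<^sup>+t. ennreal (chi_square_density \<mu> (x - (0 + x * t))) * ennreal (chi_square_density \<nu> (0 + x * t)) \<partial>lborel)"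
    by (rule nn_integral_real_affine) (use True in auto)
  also have "(\<integral>\<^sup>+t. ennreal (chi_square_density \<mu> (x - (0 + x * t))) * ennreal (chi_square_density \<nu> (0 + x * t)) \<partial>lborel)
     = (\<integral>\<^sup>+t. ennreal k * ennreal (indicator {0..1} t * (t powr (b - 1) * (1 - t) powr (a - 1))) \<partial>lborel)"
  proof (intro nn_integral_cong)
    fix t :: real
    show "ennreal (chi_square_density \<mu> (x - (0 + x * t))) * ennreal (chi_square_density \<nu> (0 + x * t))
        = ennreal k * ennreal (indicator {0..1} t * (t powr (b - 1) * (1 - t) powr (a - 1)))"
    proof (cases "0 < t \<and> t < 1")
      case True': True
      have 1: "x - x * t = x * (1 - t)" "0 < x * (1 - t)" "0 < x * t" using True True' by (auto simp: algebra_simps)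
      have 2: "(x * (1 - t)) powr (a - 1) * (x * t) powr (b - 1) = x powr (a + b - 2) * (t powr (b - 1) * (1 - t) powr (a - 1))"
      proof -
        have "(a - 1) + (b - 1) = a + b - 2" by simp
        then have "x powr (a + b - 2) = x powr (a - 1) * x powr (b - 1)" by (metis powr_add)
        then show ?thesis using True True' by (simp add: powr_mult)
      qed
      have 3: "exp (- (1 / 2 * (x * (1 - t)))) * exp (- (1 / 2 * (x * t))) = exp (- (1 / 2 * x))"
        by (simp add: mult_exp_exp algebra_simps)
      have "chi_square_density \<mu> (x - x * t) * chi_square_density \<nu> (x * t)
          = ((x * (1 - t)) powr (a - 1) * (x * t) powr (b - 1)) * (exp (- (1 / 2 * (x * (1 - t)))) * exp (- (1 / 2 * (x * t))))
            / (2 powr a * Gamma a * (2 powr b * Gamma b))"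
        unfolding chi_square_density_def 1(1) using 1(2,3) by (simp add: a_def b_def)
      also have "\<dots> = k * (t powr (b - 1) * (1 - t) powr (a - 1))"
        unfolding 2 3 k_def by (simp add: powr_add[of 2] ac_simps)
      finally show ?thesis
        using True' k chi_square_density_nonneg[OF \<mu>] by (simp add: ennreal_mult'[symmetric])
    next
      case False
      then have "t \<le> 0 \<or> 1 \<le> t" by auto
      then have "chi_square_density \<mu> (x - x * t) = 0 \<or> chi_square_density \<nu> (x * t) = 0"
        using True by (auto simp: chi_square_density_def indicator_def zero_less_mult_iff)
      moreover have "indicator {0..1} t * (t powr (b - 1) * (1 - t) powr (a - 1)) = 0"
        using False by (auto simp: indicator_def)
      ultimately show ?thesis by auto
    qed
  qed
  also have "\<dots> = ennreal k * ennreal (Beta b a)"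
  proof -
    have "(\<integral>\<^sup>+t. ennreal (indicator {0..1} t * (t powr (b - 1) * (1 - t) powr (a - 1))) \<partial>lborel) = ennreal (Beta b a)"
      by (rule nn_integral_has_integral_lebesgue[OF _ has_integral_Beta_real[OF ab(2,1)]]) simp
    then show ?thesis by (subst nn_integral_cmult) simp_all
  qed
  finally have "(\<integral>\<^sup>+y. ennreal (chi_square_density \<mu> (x - y)) * ennreal (chi_square_density \<nu> y) \<partial>lborel)
      = ennreal (x * (k * Beta b a))"
    using True k by (simp add: ennreal_mult')
  also have "x * (k * Beta b a) = chi_square_density (\<mu> + \<nu>) x"
  proof -
    have "x * x powr (a + b - 2) = x powr (a + b - 1)" using True powr_mult_base[of x "a + b - 2"] by simp
    then have "x * (k * Beta b a) = x powr (a + b - 1) * exp (- (1 / 2 * x)) / (2 powr (a + b) * Gamma (a + b))"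
      unfolding k_def Beta_def using G by (simp add: field_simps)
    then show ?thesis using True by (simp add: chi_square_density_def a_def b_def add_divide_distrib)
  qed
  finally show ?thesis .
qed

text \<open>
  The two distribution functions agree: by the symmetry of the normal density, the event \<open>Z\<^sup>2 \<le> x\<close>
  has twice the mass of \<open>[0, sqrt x]\<close>, and the substitution \<open>s = z\<^sup>2\<close> on this interval turns it into
  the integral of the chi-square density.
\<close>

lemma distr_square_std_normal:
  "distr std_normal_distribution borel (\<lambda>z. z\<^sup>2) = density lborel (\<lambda>x. ennreal (chi_square_density 1 x))"
proof (rule cdf_unique)
  interpret N: prob_space std_normal_distribution by (rule prob_space_normal_density) simp
  show "real_distribution (distr std_normal_distribution borel (\<lambda>z. z\<^sup>2))"
    by (rule N.real_distribution_distr) simp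
  interpret C: prob_space "density lborel (\<lambda>x. ennreal (chi_square_density 1 x))"
    by (rule prob_space_chi_square) simp
  show "real_distribution (density lborel (\<lambda>x. ennreal (chi_square_density 1 x)))"
    by unfold_locales auto
  show "cdf (distr std_normal_distribution borel (\<lambda>z. z\<^sup>2)) = cdf (density lborel (\<lambda>x. ennreal (chi_square_density 1 x)))"
  proof
    fix x :: real
    have "emeasure std_normal_distribution {z. z\<^sup>2 \<le> x} = (\<integral>\<^sup>+s. ennreal (chi_square_density 1 s) * indicator {..x} s \<partial>lborel)"
    proof (cases "x \<ge> 0")
      case False
      then have "{z::real. z\<^sup>2 \<le> x} = {}" by (auto simp: not_le) (meson less_le_trans not_le zero_le_power2)
      moreover have "(\<integral>\<^sup>+s. ennreal (chi_square_density 1 s) * indicator {..x} s \<partial>lborel) = (\<integral>\<^sup>+(s::real). 0 \<partial>lborel)"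
        using False by (intro nn_integral_cong) (auto simp: chi_square_density_def indicator_def)
      ultimately show ?thesis by simp
    next
      case True
      let ?\<phi> = "\<lambda>z. ennreal (std_normal_density z)"
      have set: "{z. z\<^sup>2 \<le> x} = {- sqrt x .. sqrt x}" 
      proof -
        have "z\<^sup>2 \<le> x \<longleftrightarrow> \<bar>z\<bar> \<le> sqrt x" for z using real_sqrt_le_iff[of "z\<^sup>2" x] by simp
        then show ?thesis unfolding set_eq_iff mem_Collect_eq atLeastAtMost_iff by (metis abs_le_iff minus_le_iff)
      qed
      have "emeasure std_normal_distribution {z. z\<^sup>2 \<le> x} = (\<integral>\<^sup>+z. ?\<phi> z * indicator {- sqrt x .. sqrt x} z \<partial>lborel)"
        unfolding set by (subst emeasure_density) simp_all
      (* the two halves of the interval overlap only in 0 *)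
      also have "\<dots> = (\<integral>\<^sup>+z. ?\<phi> z * indicator {0 .. sqrt x} z + ?\<phi> z * indicator {- sqrt x .. 0} z \<partial>lborel)"
        by (intro nn_integral_cong_AE, use AE_lborel_singleton[of "0::real"] in eventually_elim)
           (use True in \<open>auto simp: indicator_def\<close>)
      also have "\<dots> = (\<integral>\<^sup>+z. ?\<phi> z * indicator {0 .. sqrt x} z \<partial>lborel) + (\<integral>\<^sup>+z. ?\<phi> z * indicator {- sqrt x .. 0} z \<partial>lborel)"
        by (rule nn_integral_add) auto
      also have "(\<integral>\<^sup>+z. ?\<phi> z * indicator {- sqrt x .. 0} z \<partial>lborel)
          = ennreal \<bar>-1\<bar> * (\<integral>\<^sup>+z. ?\<phi> (0 + (-1) * z) * indicator {- sqrt x .. 0} (0 + (-1) * z) \<partial>lborel)"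
        by (rule nn_integral_real_affine) auto
      also have "\<dots> = (\<integral>\<^sup>+z. ?\<phi> z * indicator {0 .. sqrt x} z \<partial>lborel)"
        by (simp, intro nn_integral_cong) (auto simp: indicator_def std_normal_density_def)
      also have "(\<integral>\<^sup>+z. ?\<phi> z * indicator {0 .. sqrt x} z \<partial>lborel) + (\<integral>\<^sup>+z. ?\<phi> z * indicator {0 .. sqrt x} z \<partial>lborel)
          = (\<integral>\<^sup>+z. ennreal (2 * std_normal_density z) * indicator {0 .. sqrt x} z \<partial>lborel)"
        by (subst nn_integral_add[symmetric]) (auto intro!: nn_integral_cong simp: indicator_def ennreal_plus[symmetric] simp del: ennreal_plus)
      also have "\<dots> = (\<integral>\<^sup>+z. ennreal (chi_square_density 1 (z\<^sup>2) * (2 * z)) * indicator {0 .. sqrt x} z \<partial>lborel)"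
      proof (intro nn_integral_cong_AE, use AE_lborel_singleton[of "0::real"] in eventually_elim)
        fix z :: real assume "z \<noteq> 0"
        (* z = 0 is excluded, since the chi-square density is set to 0 there *)
        have *: "chi_square_density 1 (z\<^sup>2) * (2 * z) = 2 * std_normal_density z" if "z > 0"
        proof -
          have "(z\<^sup>2) powr (- (1/2)) = 1 / z"
            using that by (simp add: powr_minus powr_half_sqrt inverse_eq_divide)
          then show ?thesis
            using that by (simp add: chi_square_density_def std_normal_density_def Gamma_one_half_real powr_half_sqrt real_sqrt_mult field_simps)
        qed
        show "ennreal (2 * std_normal_density z) * indicator {0..sqrt x} z
            = ennreal (chi_square_density 1 (z\<^sup>2) * (2 * z)) * indicator {0..sqrt x} z"
        proof (cases "z > 0")
          case True
          show ?thesis unfolding *[OF True] ..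
        qed (use \<open>z \<noteq> 0\<close> in \<open>simp add: indicator_def\<close>)
      qed
      also have "\<dots> = (\<integral>\<^sup>+z. ennreal (chi_square_density 1 (z\<^sup>2) * (2 * z) * indicator {0 .. sqrt x} z) \<partial>lborel)"
        by (intro nn_integral_cong) (simp add: indicator_def)
      also have "\<dots> = (\<integral>\<^sup>+s. ennreal (chi_square_density 1 s * indicator {0\<^sup>2..(sqrt x)\<^sup>2} s) \<partial>lborel)"
        by (rule nn_integral_substitution[symmetric])
           (auto intro!: derivative_eq_intros continuous_intros simp: set_borel_measurable_def True)
      also have "\<dots> = (\<integral>\<^sup>+s. ennreal (chi_square_density 1 s) * indicator {..x} s \<partial>lborel)"
        using True by (intro nn_integral_cong) (auto simp: indicator_def chi_square_density_def)
      finally show ?thesis .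
    qed
    then have "emeasure (distr std_normal_distribution borel (\<lambda>z. z\<^sup>2)) {..x} = emeasure (density lborel (\<lambda>x. ennreal (chi_square_density 1 x))) {..x}"
      by (simp add: emeasure_distr emeasure_density vimage_def)
    then show "cdf (distr std_normal_distribution borel (\<lambda>z. z\<^sup>2)) x = cdf (density lborel (\<lambda>x. ennreal (chi_square_density 1 x))) x"
      by (simp add: cdf_def measure_def)
  qed
qed

text \<open>
  Induction on \<open>I\<close>: adding one independent square convolves the law with the density for one degree of
  freedom.
\<close>

lemma (in prob_space) sum_squares_std_normal:
  assumes "finite I" "I \<noteq> {}" "indep_vars (\<lambda>_. borel) X I"
    and "\<And>i. i \<in> I \<Longrightarrow> distr M borel (X i) = std_normal_distribution"
  shows "distr M borel (\<lambda>\<omega>. \<Sum>i\<in>I. (X i \<omega>)\<^sup>2) = density lborel (\<lambda>x. ennreal (chi_square_density (card I) x))"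
proof -
  have sq: "distr M borel (\<lambda>\<omega>. (X i \<omega>)\<^sup>2) = density lborel (\<lambda>x. ennreal (chi_square_density 1 x))"
    if "random_variable borel (X i)" "distr M borel (X i) = std_normal_distribution" for i
  proof -
    have "distr M borel (\<lambda>\<omega>. (X i \<omega>)\<^sup>2) = distr (distr M borel (X i)) borel (\<lambda>z. z\<^sup>2)"
      using that(1) by (subst distr_distr) (auto simp: o_def)
    then show ?thesis unfolding that(2) distr_square_std_normal .
  qed
  show ?thesis using assms
  proof (induction I rule: finite_ne_induct)
    case (singleton i)
    then show ?case using sq[of i] by (simp add: indep_vars_def)
  next
    case (insert i I)
    have rv: "random_variable borel (X j)" if "j \<in> insert i I" for j
      using insert.prems(1) that by (auto simp: indep_vars_def)
    have "indep_vars (\<lambda>_. borel) (\<lambda>j \<omega>. (X j \<omega>)\<^sup>2) (insert i I)"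
      by (rule indep_vars_compose2[OF insert.prems(1)]) simp
    then have ind: "indep_var borel (\<lambda>\<omega>. (X i \<omega>)\<^sup>2) borel (\<lambda>\<omega>. \<Sum>j\<in>I. (X j \<omega>)\<^sup>2)"
      by (rule indep_vars_sum[OF insert.hyps(1,3)])
    have IH: "distr M borel (\<lambda>\<omega>. \<Sum>j\<in>I. (X j \<omega>)\<^sup>2) = density lborel (\<lambda>x. ennreal (chi_square_density (card I) x))"
      using insert.prems by (intro insert.IH indep_vars_subset[OF insert.prems(1)]) auto
    have card: "real (card I) > 0" using insert.hyps by (simp add: card_gt_0_iff)
    have "distr M borel (\<lambda>\<omega>. \<Sum>j\<in>insert i I. (X j \<omega>)\<^sup>2) = distr M borel (\<lambda>\<omega>. (X i \<omega>)\<^sup>2 + (\<Sum>j\<in>I. (X j \<omega>)\<^sup>2))"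
      using insert.hyps by simp
    also have "\<dots> = convolution (distr M borel (\<lambda>\<omega>. (X i \<omega>)\<^sup>2)) (distr M borel (\<lambda>\<omega>. \<Sum>j\<in>I. (X j \<omega>)\<^sup>2))"
      using rv by (intro sum_indep_random_variable[OF ind]) auto
    also have "\<dots> = density lborel (\<lambda>x. \<integral>\<^sup>+y. ennreal (chi_square_density 1 (x - y)) * ennreal (chi_square_density (card I) y) \<partial>lborel)"
      unfolding IH sq[OF rv[OF insertI1] insert.prems(2)[OF insertI1]] using card
      by (intro convolution_density prob_space.finite_measure prob_space_chi_square) auto
    also have "\<dots> = density lborel (\<lambda>x. ennreal (chi_square_density (card (insert i I)) x))"
      using insert.hyps card by (simp add: chi_square_convolution)
    finally show ?case .
  qed
qed

section \<open>Student's t-distribution\<close>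

text \<open>
  Given \<open>S = s\<close>, the quotient \<open>W / sqrt (S/n)\<close> is normal with variance \<open>n/s\<close>. The integral
  averages this conditional density over the chi-square law of \<open>S\<close>. It is a Gamma integral with
  exponent \<open>(n+1)/2\<close> and rate \<open>(1 + u\<^sup>2/n)/2\<close>.
\<close>

lemma student_t_density_mixture:
  assumes n: "n > 0"
  shows "(\<integral>\<^sup>+s. ennreal (chi_square_density n s) * ennreal (sqrt (s / n) * std_normal_density (u * sqrt (s / n))) \<partial>lborel)
     = ennreal (student_t_density n u)"
proof -
  define m r where "m = (real n + 1) / 2" and "r = (1 + u\<^sup>2 / n) / 2"
  have r: "r > 0" using n by (simp add: r_def add_pos_nonneg)
  have m: "m > 0" by (simp add: m_def)
  have G: "Gamma (real n / 2) > 0" "Gamma m > 0" using n m by (auto intro: Gamma_real_pos)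
  define k where "k = 1 / (2 powr (n / 2) * Gamma (n / 2) * sqrt (2 * pi * n))"
  have k: "k \<ge> 0" using G by (simp add: k_def)
  have "(\<integral>\<^sup>+s. ennreal (chi_square_density n s) * ennreal (sqrt (s / n) * std_normal_density (u * sqrt (s / n))) \<partial>lborel)
      = (\<integral>\<^sup>+s. ennreal k * ennreal (indicator {0<..} s * (s powr (m - 1) * exp (- (r * s)))) \<partial>lborel)"
  proof (intro nn_integral_cong)
    fix s :: real
    show "ennreal (chi_square_density n s) * ennreal (sqrt (s / n) * std_normal_density (u * sqrt (s / n)))
        = ennreal k * ennreal (indicator {0<..} s * (s powr (m - 1) * exp (- (r * s))))"
    proof (cases "s > 0")
      case True
      have 1: "s powr (n / 2 - 1) * sqrt s = s powr (m - 1)"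
        using True by (simp add: powr_half_sqrt[symmetric] powr_add[symmetric] m_def field_simps)
      have 2: "exp (- (1 / 2 * s)) * exp (- (u * sqrt (s / n))\<^sup>2 / 2) = exp (- (r * s))"
        using True n by (simp add: mult_exp_exp r_def power_mult_distrib field_simps)
      have "chi_square_density n s * (sqrt (s / n) * std_normal_density (u * sqrt (s / n)))
         = (s powr (n / 2 - 1) * sqrt s) * (exp (- (1 / 2 * s)) * exp (- (u * sqrt (s / n))\<^sup>2 / 2)) * k"
        using True by (simp add: chi_square_density_def std_normal_density_def k_def real_sqrt_mult real_sqrt_divide ac_simps)
      also have "\<dots> = k * (s powr (m - 1) * exp (- (r * s)))" unfolding 1 2 by simp
      finally show ?thesis
        using True k n chi_square_density_nonneg[of n s] by (simp add: ennreal_mult'[symmetric])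
    qed (simp add: chi_square_density_def)
  qed
  also have "\<dots> = ennreal k * ennreal (Gamma m / r powr m)"
    using nn_integral_Gamma_scaled[OF m r] by (subst nn_integral_cmult) auto
  also have "\<dots> = ennreal (k * (Gamma m / r powr m))" by (rule ennreal_mult'[OF k, symmetric])
  also have "k * (Gamma m / r powr m) = student_t_density n u"
  proof -
    have "1 + u\<^sup>2 / n > 0" using r by (simp add: r_def)
    then have 1: "r powr m = (1 + u\<^sup>2 / n) powr m / 2 powr m" by (simp add: r_def powr_divide)
    have 2: "2 powr m = 2 powr (n / 2) * sqrt 2"
      by (simp add: m_def powr_half_sqrt[symmetric] powr_add[symmetric] add_divide_distrib)
    have "- (real n + 1) / 2 = - m" unfolding m_def by (rule minus_divide_left[symmetric])
    then have 3: "(1 + u\<^sup>2 / n) powr (- (real n + 1) / 2) = 1 / (1 + u\<^sup>2 / n) powr m"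
      by (simp only: powr_minus inverse_eq_divide)
    show ?thesis
      unfolding student_t_density_def k_def 3 1 2 m_def[symmetric]
      by (simp add: real_sqrt_mult)
  qed
  finally show ?thesis .
qed

lemma student_t_density_measurable[measurable]: "student_t_density n \<in> borel_measurable borel"
  unfolding student_t_density_def[abs_def] by measurable

text \<open>
  The joint law of \<open>W\<close> and \<open>S\<close> is a product, so the probability of a Borel set is a double integral. The
  substitution \<open>w = u sqrt (s/n)\<close> and an exchange of the two integrals leave the mixture of
  \<open>student_t_density_mixture\<close>.
\<close>

lemma (in prob_space) student_t_quotient:
  assumes n: "n > 0" and ind: "indep_var borel W borel S"
    and W: "distr M borel W = std_normal_distribution"
    and S: "distr M borel S = density lborel (\<lambda>x. ennreal (chi_square_density n x))"
  shows "distr M borel (\<lambda>\<omega>. W \<omega> / sqrt (S \<omega> / n)) = student_t n"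
proof (rule measure_eqI)
  fix A assume "A \<in> sets (distr M borel (\<lambda>\<omega>. W \<omega> / sqrt (S \<omega> / n)))"
  then have A[measurable]: "A \<in> sets borel" by simp
  have rv[measurable]: "random_variable borel W" "random_variable borel S"
    using ind by (auto simp: indep_var_distribution_eq)
  let ?N = "std_normal_distribution" and ?C = "density lborel (\<lambda>x. ennreal (chi_square_density n x))"
  interpret N: prob_space ?N by (rule prob_space_normal_density) simp
  interpret C: prob_space ?C by (rule prob_space_chi_square) (use n in simp)
  interpret NC: pair_sigma_finite ?N ?C ..
  have "distr M borel (\<lambda>\<omega>. W \<omega> / sqrt (S \<omega> / n)) = distr (distr M (borel \<Otimes>\<^sub>M borel) (\<lambda>\<omega>. (W \<omega>, S \<omega>))) borel (\<lambda>(w, s). w / sqrt (s / n))"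
    by (subst distr_distr) (auto simp: o_def)
  also have "distr M (borel \<Otimes>\<^sub>M borel) (\<lambda>\<omega>. (W \<omega>, S \<omega>)) = ?N \<Otimes>\<^sub>M ?C"
    using ind unfolding indep_var_distribution_eq W S by simp
  finally have "emeasure (distr M borel (\<lambda>\<omega>. W \<omega> / sqrt (S \<omega> / n))) A
      = (\<integral>\<^sup>+p. indicator A (case p of (w, s) \<Rightarrow> w / sqrt (s / n)) \<partial>(?N \<Otimes>\<^sub>M ?C))"
    by (simp add: nn_integral_distr flip: nn_integral_indicator)
  also have "\<dots> = (\<integral>\<^sup>+s. (\<integral>\<^sup>+w. indicator A (w / sqrt (s / n)) \<partial>?N) \<partial>?C)"
    by (subst NC.nn_integral_snd[symmetric]) auto
  also have "\<dots> = (\<integral>\<^sup>+s. ennreal (chi_square_density n s) * (\<integral>\<^sup>+w. ennreal (std_normal_density w) * indicator A (w / sqrt (s / n)) \<partial>lborel) \<partial>lborel)"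
    by (subst nn_integral_density) (auto simp: nn_integral_density)
  also have "\<dots> = (\<integral>\<^sup>+s. (\<integral>\<^sup>+u. ennreal (chi_square_density n s) * ennreal (sqrt (s / n) * std_normal_density (u * sqrt (s / n))) * indicator A u \<partial>lborel) \<partial>lborel)"
  proof (intro nn_integral_cong)
    fix s :: real
    show "ennreal (chi_square_density n s) * (\<integral>\<^sup>+w. ennreal (std_normal_density w) * indicator A (w / sqrt (s / n)) \<partial>lborel)
      = (\<integral>\<^sup>+u. ennreal (chi_square_density n s) * ennreal (sqrt (s / n) * std_normal_density (u * sqrt (s / n))) * indicator A u \<partial>lborel)"
    proof (cases "s > 0")
      case True
      define h where "h = sqrt (s / n)"
      have h: "h > 0" using True n by (simp add: h_def)
      have "(\<integral>\<^sup>+w. ennreal (std_normal_density w) * indicator A (w / h) \<partial>lborel)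
          = ennreal \<bar>h\<bar> * (\<integral>\<^sup>+u. ennreal (std_normal_density (0 + h * u)) * indicator A ((0 + h * u) / h) \<partial>lborel)"
        by (rule nn_integral_real_affine) (use h in auto)
      also have "\<dots> = (\<integral>\<^sup>+u. ennreal (h * std_normal_density (u * h)) * indicator A u \<partial>lborel)"
        using h by (subst nn_integral_cmult[symmetric]) (auto simp: ennreal_mult' ac_simps)
      finally show ?thesis
        by (subst nn_integral_cmult[symmetric]) (auto simp: h_def[symmetric] mult.assoc nn_integral_cmult)
    qed (simp add: chi_square_density_def)
  qed
  also have "\<dots> = (\<integral>\<^sup>+u. (\<integral>\<^sup>+s. ennreal (chi_square_density n s) * ennreal (sqrt (s / n) * std_normal_density (u * sqrt (s / n))) * indicator A u \<partial>lborel) \<partial>lborel)"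
    by (rule lborel_pair.Fubini') measurable
  also have "\<dots> = (\<integral>\<^sup>+u. ennreal (student_t_density n u) * indicator A u \<partial>lborel)"
    using n by (intro nn_integral_cong) (subst nn_integral_multc, auto simp: student_t_density_mixture)
  also have "\<dots> = emeasure (student_t n) A"
    unfolding student_t_def by (rule emeasure_density[symmetric]) auto
  finally show "emeasure (distr M borel (\<lambda>\<omega>. W \<omega> / sqrt (S \<omega> / n))) A = emeasure (student_t n) A" .
qed (simp add: student_t_def)

lemma student_t_symmetric: "distr (student_t n) borel uminus = student_t n"
proof (rule measure_eqI)
  fix A assume "A \<in> sets (distr (student_t n) borel uminus)"
  then have A[measurable]: "A \<in> sets borel" by simp
  have "emeasure (distr (student_t n) borel uminus) A = (\<integral>\<^sup>+x. indicator A (- x) \<partial>student_t n)"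
    by (simp add: student_t_def nn_integral_distr flip: nn_integral_indicator)
  also have "\<dots> = (\<integral>\<^sup>+x. ennreal (student_t_density n x) * indicator A (- x) \<partial>lborel)"
    unfolding student_t_def by (rule nn_integral_density) auto
  also have "\<dots> = ennreal \<bar>-1\<bar> * (\<integral>\<^sup>+x. ennreal (student_t_density n (0 + (-1) * x)) * indicator A (- (0 + (-1) * x)) \<partial>lborel)"
    by (rule nn_integral_real_affine) auto
  also have "\<dots> = (\<integral>\<^sup>+x. ennreal (student_t_density n x) * indicator A x \<partial>lborel)"
    by (simp add: student_t_density_def)
  also have "\<dots> = emeasure (student_t n) A"
    unfolding student_t_def by (rule emeasure_density[symmetric]) auto
  finally show "emeasure (distr (student_t n) borel uminus) A = emeasure (student_t n) A" .
qed (simp add: student_t_def)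

section \<open>Quantiles of symmetric distributions\<close>

text \<open>
  The infimum in the definition of the quantile is attained, because the distribution function is
  continuous from the right; its limits at the two infinities make the set nonempty and bounded below.
\<close>

lemma (in real_distribution) quantile_cdf_ge:
  assumes p: "0 < p" "p < 1"
  shows "p \<le> cdf M (quantile M p)"
proof -
  let ?S = "{x. p \<le> cdf M x}"
  have "eventually (\<lambda>x. p < cdf M x) at_top"
    using order_tendstoD(1)[OF cdf_lim_at_top_prob p(2)] .
  then have ne: "?S \<noteq> {}" by (auto simp: eventually_at_top_linorder intro: less_imp_le)
  have "eventually (\<lambda>x. cdf M x < p) at_bot"
    using order_tendstoD(2)[OF cdf_lim_at_bot p(1)] .
  then obtain l where l: "\<And>x. x \<le> l \<Longrightarrow> cdf M x < p" by (auto simp: eventually_at_bot_linorder)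
  have bdd: "bdd_below ?S" using l by (intro bdd_belowI[of _ l]) (metis linorder_not_le mem_Collect_eq nle_le)
  have "p \<le> cdf M x" if "x > quantile M p" for x
  proof -
    from that obtain y where "y \<in> ?S" "y < x" using cInf_lessD[OF ne, of x] unfolding quantile_def by blast
    then show ?thesis using cdf_nondecreasing[of y x] by simp
  qed
  then have "eventually (\<lambda>x. p \<le> cdf M x) (at_right (quantile M p))"
    by (auto simp: eventually_at_filter)
  then show ?thesis
    using cdf_is_right_cont[of "quantile M p"] unfolding continuous_within
    by (intro tendsto_lowerbound) auto
qed

text \<open>
  By symmetry both tails beyond the quantile have probability at most \<open>1 - p\<close>. The quantile is
  nonnegative since negative numbers have distribution function at most \<open>1/2 < p\<close>.
\<close>

lemma (in real_distribution) symmetric_quantile: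
  assumes sym: "distr M borel uminus = M" and p: "1 / 2 < p" "p < 1"
  shows "0 \<le> quantile M p" and "2 * p - 1 \<le> prob {- quantile M p .. quantile M p}"
proof -
  have reflect: "prob (uminus -` A) = prob A" if "A \<in> sets borel" for A
  proof -
    have "prob (uminus -` A) = measure (distr M borel uminus) A"
      using that by (simp add: measure_distr)
    then show ?thesis by (simp add: sym)
  qed
  have neg: "cdf M x \<le> 1 / 2" if "x < 0" for x
  proof -
    have "prob {..x} + prob (uminus -` {..x}) = prob ({..x} \<union> uminus -` {..x})"
      using that by (intro finite_measure_Union[symmetric]) (auto simp: vimage_def)
    also have "\<dots> \<le> 1" by simp
    finally show ?thesis using reflect[of "{..x}"] by (simp add: cdf_def)
  qed
  let ?t = "quantile M p"
  have ge: "p \<le> cdf M ?t" using quantile_cdf_ge p by simp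
  then show "0 \<le> ?t" using neg[of ?t] p by (meson linorder_not_le order_less_le_trans)
  have "prob {?t<..} = 1 - cdf M ?t"
    using prob_compl[of "{..?t}"] by (simp add: cdf_def Compl_eq_Diff_UNIV[symmetric] flip: Compl_atMost)
  then have upper: "prob {?t<..} \<le> 1 - p" using ge by simp
  have "uminus -` {?t<..} = {..<- ?t}" by (auto simp: vimage_def)
  then have lower: "prob {..<- ?t} \<le> 1 - p" using upper reflect[of "{?t<..}"] by simp
  have "1 = prob ({- ?t .. ?t} \<union> ({..<- ?t} \<union> {?t<..}))"
    by (subst prob_space[symmetric]) (auto intro!: arg_cong[where f=prob])
  also have "\<dots> \<le> prob {- ?t .. ?t} + (prob {..<- ?t} + prob {?t<..})"
    by (intro order_trans[OF measure_Un_le] add_left_mono measure_Un_le) auto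
  finally show "2 * p - 1 \<le> prob {- ?t .. ?t}" using upper lower by simp
qed

section \<open>The studentized coordinate and the confidence interval\<close>

lemma (in prob_space) student_t_of_std_normals:
  assumes I: "finite I" "I \<noteq> {}" "j \<notin> I" and ind: "indep_vars (\<lambda>_. borel) X (insert j I)"
    and std: "\<And>i. i \<in> insert j I \<Longrightarrow> distr M borel (X i) = std_normal_distribution"
  shows "distr M borel (\<lambda>\<omega>. X j \<omega> / sqrt ((\<Sum>i\<in>I. (X i \<omega>)\<^sup>2) / card I)) = student_t (card I)"
proof (rule student_t_quotient)
  show "card I > 0" using I by (simp add: card_gt_0_iff)
  define Y where "Y i x = (if i = j then x else x\<^sup>2)" for i and x :: real
  have "indep_vars (\<lambda>_. borel) (\<lambda>i \<omega>. Y i (X i \<omega>)) (insert j I)"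
    by (rule indep_vars_compose2[OF ind]) (auto simp: Y_def[abs_def])
  then have "indep_var borel (\<lambda>\<omega>. Y j (X j \<omega>)) borel (\<lambda>\<omega>. \<Sum>i\<in>I. Y i (X i \<omega>))"
    by (rule indep_vars_sum[OF I(1,3)])
  moreover have "(\<Sum>i\<in>I. Y i (X i \<omega>)) = (\<Sum>i\<in>I. (X i \<omega>)\<^sup>2)" for \<omega>
    using I(3) by (intro sum.cong) (auto simp: Y_def)
  ultimately show "indep_var borel (X j) borel (\<lambda>\<omega>. \<Sum>i\<in>I. (X i \<omega>)\<^sup>2)" by (simp add: Y_def)
  show "distr M borel (\<lambda>\<omega>. \<Sum>i\<in>I. (X i \<omega>)\<^sup>2) = density lborel (\<lambda>x. ennreal (chi_square_density (card I) x))"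
    using I std by (intro sum_squares_std_normal indep_vars_subset[OF ind]) auto
qed (simp add: std)

lemma gaussian_marginal_standardized:
  assumes M: "is_gaussian M \<xi> C" and v: "inner (C b) b > 0"
  shows "distr M borel (\<lambda>y. (inner b y - inner b \<xi>) / sqrt (inner (C b) b)) = std_normal_distribution"
proof -
  interpret prob_space M using M by (simp add: is_gaussian_def)
  have s: "sets M = sets borel" using M by (simp add: is_gaussian_def)
  have m: "inner b \<in> borel_measurable M"
    unfolding measurable_cong_sets[OF s refl] by (intro borel_measurable_continuous_onI continuous_intros)
  have "distr M borel (inner b) = density lborel (\<lambda>x. ennreal (normal_density (inner b \<xi>) (sqrt (inner (C b) b)) x))"
    using M v by (auto simp: is_gaussian_def normal_law_def)
  then have "distributed M lborel (inner b) (normal_density (inner b \<xi>) (sqrt (inner (C b) b)))"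
    using m by (simp add: distributed_def distr_cong[OF refl sets_lborel refl])
  then have "distributed M lborel (\<lambda>y. (inner b y - inner b \<xi>) / sqrt (inner (C b) b)) std_normal_density"
    by (subst normal_standard_normal_convert[symmetric]) (use v in auto)
  then show ?thesis
    by (simp add: distributed_def distr_cong[OF refl sets_lborel refl])
qed

text \<open>
  Excludes the null set where the denominator of the studentized quotient vanishes. There the quotient
  is \<open>0\<close> by convention and says nothing about its numerator.
\<close>

lemma gaussian_marginal_AE_neq_mean:
  assumes M: "is_gaussian M \<xi> C" and v: "inner (C b) b > 0"
  shows "AE y in M. inner b y \<noteq> inner b \<xi>"
proof -
  define X where "X y = (inner b y - inner b \<xi>) / sqrt (inner (C b) b)" for y
  have s: "sets M = sets borel" using M by (simp add: is_gaussian_def)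
  have m: "X \<in> borel_measurable M"
    unfolding measurable_cong_sets[OF s refl] X_def[abs_def]
    by (intro borel_measurable_continuous_onI continuous_intros) (use v in simp)
  have "AE x in std_normal_distribution. x \<noteq> 0"
    by (subst AE_density) (use AE_lborel_singleton[of "0::real"] in auto)
  then have "AE x in distr M borel X. x \<noteq> 0"
    unfolding X_def[abs_def] gaussian_marginal_standardized[OF M v] .
  then have "AE y in M. X y \<noteq> 0" by (subst (asm) AE_distr_iff[OF m]) auto
  then show ?thesis by (rule AE_mp) (auto simp: X_def)
qed

text \<open>
  The vector \<open>w\<close> and the eigenvectors in \<open>F\<close> are pairwise uncorrelated under \<open>C\<close>. The factor \<open>1/l\<close>
  standardizes the squared coordinates, whose common variance is \<open>l\<close>.
\<close>

lemma gaussian_studentized: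
  fixes C :: "'a::real_inner \<Rightarrow> 'a"
  assumes M: "is_gaussian M \<xi> C" and C: "linear C" "nonnegative_op C"
    and F: "finite F" "F \<noteq> {}" "orthonormal F" and l: "l > 0"
    and eigen: "\<And>e. e \<in> F \<Longrightarrow> C e = l *\<^sub>R e" and mean: "\<And>e. e \<in> F \<Longrightarrow> inner e \<xi> = 0"
    and w: "inner (C w) w > 0" "\<And>e. e \<in> F \<Longrightarrow> inner w e = 0" "\<And>e. e \<in> F \<Longrightarrow> inner (C w) e = 0"
  shows "distr M borel (\<lambda>y. (inner w y - inner w \<xi>) / sqrt (inner (C w) w)
            / sqrt ((\<Sum>e\<in>F. (inner e y)\<^sup>2) / l / card F)) = student_t (card F)"
proof -
  interpret prob_space M using M by (simp add: is_gaussian_def)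
  define X where "X b y = (inner b y - inner b \<xi>) / sqrt (inner (C b) b)" for b y
  have unit: "inner e e = 1" if "e \<in> F" for e using F(3) that by (simp add: orthonormal_def norm_eq_1)
  have wF: "w \<notin> F" using w(2)[of w] unit[of w] by auto
  have pos: "inner (C b) b > 0" if "b \<in> insert w F" for b
    using that w(1) l unit by (auto simp: eigen)
  have "inner (C a) b = 0" if "a \<in> insert w F" "b \<in> insert w F" "a \<noteq> b" for a b
    using that w(2,3) F(3) by (auto simp: eigen orthonormal_def pairwise_def orthogonal_def inner_commute)
  then have "indep_vars (\<lambda>_. borel) inner (insert w F)"
    using F(1) by (intro gaussian_uncorrelated_imp_indep[OF M C]) auto
  then have "indep_vars (\<lambda>_. borel) (\<lambda>b y. (inner b y - inner b \<xi>) / sqrt (inner (C b) b)) (insert w F)"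
    by (rule indep_vars_compose2) simp
  then have "indep_vars (\<lambda>_. borel) X (insert w F)" by (simp add: X_def[abs_def])
  moreover have "distr M borel (X b) = std_normal_distribution" if "b \<in> insert w F" for b
    unfolding X_def[abs_def] by (rule gaussian_marginal_standardized[OF M pos[OF that]])
  ultimately have "distr M borel (\<lambda>y. X w y / sqrt ((\<Sum>e\<in>F. (X e y)\<^sup>2) / card F)) = student_t (card F)"
    by (intro student_t_of_std_normals F wF)
  moreover have "(\<Sum>e\<in>F. (X e y)\<^sup>2) = (\<Sum>e\<in>F. (inner e y)\<^sup>2) / l" for y
    unfolding sum_divide_distrib
    using l by (intro sum.cong) (auto simp: X_def eigen mean unit power_divide)
  ultimately show ?thesis by (simp add: X_def)
qed

text \<open>
  On the orthogonal sum \<open>V \<oplus> V\<^sup>\<bottom>\<close> the operator \<open>T\<close> is \<open>0\<close> on \<open>V\<close> and equals \<open>Q\<close> on the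
  invariant subspace \<open>V\<^sup>\<bottom>\<close>, so it inherits the properties of \<open>Q\<close>. A nuclear expansion of \<open>T\<close> arises
  by projecting the vectors \<open>a\<^sub>i\<close> of one of \<open>Q\<close> to \<open>V\<^sup>\<bottom>\<close>.
\<close>

lemma residual_operator:
  fixes V :: "'a::{real_inner, complete_space} set" and Q :: "'a \<Rightarrow> 'a"
  assumes V: "subspace V" "closed V"
    and Q: "bounded_linear Q" "nonnegative_op Q" "self_adjoint Q" "nuclear Q" and inv: "Q ` (V\<^sup>\<bottom>) \<subseteq> V\<^sup>\<bottom>"
  defines "T \<equiv> \<lambda>x. Q (x - orth_proj V x)"
  shows "bounded_linear T" and "nonnegative_op T" and "self_adjoint T" and "nuclear T"
    and "T x \<in> V\<^sup>\<bottom>"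
proof -
  interpret Q: bounded_linear Q by fact
  let ?p = "orth_proj V"
  interpret p: bounded_linear ?p by (rule bounded_linear_orth_proj[OF V])
  have perp: "x - ?p x \<in> V\<^sup>\<bottom>" for x
    using orth_proj_orthogonal[OF V, of _ x] by (simp add: orthogonal_comp_def orthogonal_def inner_commute)
  have p0: "inner (?p x) y = 0" if "y \<in> V\<^sup>\<bottom>" for x y
    using orth_proj_in[OF V, of x] that by (simp add: orthogonal_comp_def orthogonal_def)
  have TV: "T x \<in> V\<^sup>\<bottom>" for x using inv perp[of x] by (auto simp: T_def)
  then show "T x \<in> V\<^sup>\<bottom>" .
  show "bounded_linear T" unfolding T_def
    by (intro bounded_linear_compose[OF Q(1)] bounded_linear_sub bounded_linear_ident p.bounded_linear_axioms)
  have T: "inner (T x) y = inner (Q (x - ?p x)) (y - ?p y)" for x y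
    using p0[OF TV, of y x] by (simp add: T_def inner_diff_left inner_diff_right inner_commute)
  then show "nonnegative_op T" using Q(2) by (simp add: nonnegative_op_def)
  show "self_adjoint T"
    unfolding self_adjoint_def by (metis T Q(3) inner_commute self_adjoint_def)
  obtain a b :: "nat \<Rightarrow> 'a" where ab: "summable (\<lambda>i. norm (a i) * norm (b i))"
    "\<And>x. (\<lambda>i. inner (a i) x *\<^sub>R b i) sums Q x"
    using Q(4) unfolding nuclear_def by blast
  have sw: "inner z (x - ?p x) = inner (z - ?p z) x" for z x
    using p0[OF perp, of z x] p0[OF perp, of x z] by (simp add: inner_diff_left inner_diff_right inner_commute)
  have nle: "norm (z - ?p z) \<le> norm z" for z
  proof -
    have "(norm (z - ?p z))\<^sup>2 = inner (z - ?p z) z"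
      using p0[OF perp, of z z] by (simp add: power2_norm_eq_inner inner_diff_right inner_commute)
    also have "\<dots> \<le> norm (z - ?p z) * norm z" by (rule norm_cauchy_schwarz)
    finally show ?thesis by (cases "norm (z - ?p z) = 0") (auto simp: power2_eq_square)
  qed
  show "nuclear T" unfolding nuclear_def
  proof (rule exI[of _ "\<lambda>i. a i - ?p (a i)"], rule exI[of _ b], intro conjI allI)
    show "summable (\<lambda>i. norm (a i - ?p (a i)) * norm (b i))"
      by (rule summable_comparison_test'[OF ab(1)]) (simp add: mult_right_mono nle)
    show "(\<lambda>i. inner (a i - ?p (a i)) x *\<^sub>R b i) sums T x" for x
      using ab(2)[of "x - ?p x"] by (simp add: T_def sw)
  qed
qed

theorem corollary10p4:
  fixes Q :: "'h::{real_inner, polish_space} \<Rightarrow> 'h"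
    and A :: "'g::{real_inner, polish_space} \<Rightarrow> 'h"
    and P :: "'g \<times> real \<Rightarrow> 'h measure"
    and U :: "'h set" and R :: "'h \<Rightarrow> 'h"
    and \<zeta> :: "'h \<Rightarrow> 'h" and \<beta>_hat :: "'h \<Rightarrow> 'g" and s :: "'h \<Rightarrow> real"
    and \<tau> lam q \<alpha> :: real and n :: nat and c :: 'g
  assumes Q_op: "bounded_linear Q" "nonnegative_op Q" "self_adjoint Q" "nuclear Q"
    and A_op: "bounded_linear A" "inj A"
    and U_def: "U = range A"
    and U_closed: "closed U"
    and U_invariant: "Q ` U \<subseteq> U" "Q ` (U\<^sup>\<bottom>) \<subseteq> U\<^sup>\<bottom>"
    and model: "\<And>\<beta> v. v > 0 \<Longrightarrow> is_gaussian (P (\<beta>, v)) (A \<beta>) (\<lambda>x. v *\<^sub>R Q x)"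
    and zeta_def: "\<And>y. \<zeta> y = orth_proj U y"
    and beta_hat_def: "\<And>y. \<beta>_hat y = inv A (\<zeta> y)"
    and R_def: "\<And>x. R x = Q (x - orth_proj U x)"
    and R_nonzero: "R \<noteq> (\<lambda>x. 0)"
    and tau_def: "\<tau> = op_trace R"
    and lambda_def: "lam = onorm R"
    and n_def: "n = dim {x. lam *\<^sub>R x - R x = 0}"
    and s_def: "\<And>y. s y \<ge> 0 \<and> (s y)\<^sup>2 = (norm (y - \<zeta> y))\<^sup>2 / op_trace R"
    and q_def: "q = inner (Q (adjoint_on U (inv A) c)) (orth_proj U (adjoint_on U (inv A) c))"
    and q_pos: "q > 0"
    and alpha: "\<alpha> \<in> {0<..<1}"
  shows "confidence_interval P (UNIV \<times> {0<..}) (\<lambda>(\<beta>, v). inner c \<beta>) (1 - \<alpha>)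
    (\<lambda>y. let r = sqrt (\<tau> / (lam * real n)) * quantile (student_t n) (1 - \<alpha> / 2) * s y * sqrt q
         in {inner c (\<beta>_hat y) - r .. inner c (\<beta>_hat y) + r})"
proof -
  interpret Q: bounded_linear Q by fact
  interpret A: bounded_linear A by fact
  have U: "subspace U" "closed U"
    using linear_subspace_image[OF A.linear_axioms subspace_UNIV] U_closed by (auto simp: U_def)
  have R_eq: "R = (\<lambda>x. Q (x - orth_proj U x))" by (rule ext) (rule R_def)
  note R = residual_operator[OF U Q_op U_invariant(2), folded R_eq]
  have \<tau>: "\<tau> > 0" unfolding tau_def by (rule op_trace_pos[OF R(1,3,2,4) R_nonzero])

  obtain z where z: "z \<noteq> 0" "R z = lam *\<^sub>R z"
    using onorm_is_eigenvalue[OF R(1,3,2) nuclear_compact_image_cball[OF R(4)] R_nonzero]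
    unfolding lambda_def by blast
  have lam: "lam > 0"
    using R_nonzero onorm_pos_lt[OF R(1)] by (auto simp: lambda_def)
  obtain F where F: "finite F" "orthonormal F" "span F = {x. R x = lam *\<^sub>R x}"
    using nuclear_eigenspace_orthonormal_basis[OF R(1,4) lam] by blast
  have "F \<noteq> {}" using F(3) z by auto
  have n: "n = card F"
  proof -
    have "span F = {x. lam *\<^sub>R x - R x = 0}" unfolding F(3) by (auto simp: algebra_simps)
    then show ?thesis
      unfolding n_def using dim_eq_card[of F] orthonormal_independent[OF F(2)] by (metis span_span)
  qed
  have n0: "n > 0" unfolding n using F(1) \<open>F \<noteq> {}\<close> by (simp add: card_gt_0_iff)
  have eigen: "R e = lam *\<^sub>R e" if "e \<in> F" for e using span_base[OF that] F(3) by blast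
  have perp: "inner e u = 0" if "e \<in> F" "u \<in> U" for e u
  proof -
    have "inner u (R e) = 0" using R(5)[of e] that(2) by (simp add: orthogonal_comp_def orthogonal_def R_def)
    then show ?thesis using lam eigen[OF that(1)] by (simp add: inner_commute)
  qed
  have Qe: "Q e = lam *\<^sub>R e" if "e \<in> F" for e
  proof -
    have "orth_proj U e = 0"
      using U(1) perp[OF that] by (intro orth_proj_eqI) (auto simp: subspace_0)
    then show ?thesis using eigen[OF that] by (simp add: R_def)
  qed

  define w where "w = adjoint_on U (inv A) c"
  have w: "w \<in> U" "\<And>x. inner w (A x) = inner c x"
    using adjoint_on_inverse[OF A_op, of c] U_closed unfolding w_def U_def by auto
  have "orth_proj U w = w" using U(1) w(1) by (intro orth_proj_eqI) auto
  then have q: "q = inner (Q w) w" by (simp add: q_def w_def)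
  have Qw: "Q w \<in> U" using U_invariant(1) w(1) by blast
  have \<beta>_hat: "inner c (\<beta>_hat y) = inner w y" for y
  proof -
    obtain x where x: "orth_proj U y = A x" using orth_proj_in[OF U, of y] by (auto simp: U_def)
    have "inner c (\<beta>_hat y) = inner w (orth_proj U y)"
      using A_op(2) by (simp add: beta_hat_def zeta_def x w(2))
    also have "\<dots> = inner w y"
      using orth_proj_orthogonal[OF U w(1), of y] by (simp add: inner_diff_left inner_commute[of w])
    finally show ?thesis .
  qed

  define t where "t = quantile (student_t n) (1 - \<alpha> / 2)"
  (* the trace cancels in the half-width, which is k times the norm of the residual *)
  define k where "k = t * sqrt q / sqrt (lam * n)"
  have radius: "sqrt (\<tau> / (lam * n)) * t * s y * sqrt q = k * norm (y - orth_proj U y)" for y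
  proof -
    have "(s y)\<^sup>2 = (norm (y - orth_proj U y) / sqrt \<tau>)\<^sup>2"
      using s_def[of y] \<tau> by (simp add: zeta_def power_divide tau_def)
    then have "s y = norm (y - orth_proj U y) / sqrt \<tau>"
      using s_def[of y] \<tau> by (subst (asm) power2_eq_iff_nonneg) auto
    then show ?thesis using \<tau> by (simp add: k_def real_sqrt_divide)
  qed

  show ?thesis unfolding confidence_interval_def
  proof clarsimp
    fix \<beta> :: 'g and v :: real assume v: "v > 0"
    define M where "M = P (\<beta>, v)"
    define C where "C x = v *\<^sub>R Q x" for x
    have M: "is_gaussian M (A \<beta>) C" using model[OF v] by (simp add: M_def C_def[abs_def])
    interpret prob_space M using M by (simp add: is_gaussian_def)
    have sM: "sets M = sets borel" using M by (simp add: is_gaussian_def)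
    have C: "linear C" "nonnegative_op C"
      unfolding C_def[abs_def] using Q.linear_axioms v Q_op(2)
      by (auto intro: linear_compose_scale_right simp: nonnegative_op_def)
    have Cw: "inner (C w) w = v * q" by (simp add: C_def q)
    define S where "S y = (\<Sum>e\<in>F. (inner e y)\<^sup>2)" for y
    define T where "T y = (inner w y - inner w (A \<beta>)) / sqrt (v * q) / sqrt (S y / (v * lam) / n)" for y
    have T: "distr M borel T = student_t n"
      unfolding T_def[abs_def] S_def n Cw[symmetric]
    proof (rule gaussian_studentized[OF M C F(1) \<open>F \<noteq> {}\<close> F(2)])
      show "inner w e = 0" "inner (C w) e = 0" if "e \<in> F" for e
        using perp[OF that w(1)] perp[OF that Qw] by (simp_all add: C_def inner_commute)
    qed (use v lam q_pos Cw perp Qe U_def in \<open>auto simp: C_def\<close>)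
    have Tm: "T \<in> borel_measurable M"
      unfolding measurable_cong_sets[OF sM refl] T_def[abs_def] S_def
      by measurable
    interpret T: real_distribution "student_t n"
      unfolding T[symmetric] using real_distribution_distr[OF Tm] .
    have p: "1 / 2 < 1 - \<alpha> / 2" "1 - \<alpha> / 2 < 1" using alpha by auto
    note t = T.symmetric_quantile[OF student_t_symmetric p, folded t_def]

    have bound: "\<bar>inner w y - inner w (A \<beta>)\<bar> \<le> k * norm (y - orth_proj U y)"
      if y: "S y \<noteq> 0" "\<bar>T y\<bar> \<le> t" for y
    proof -
      have "S y > 0" using y(1) by (simp add: S_def sum_nonneg order.not_eq_order_implies_strict)
      define h where "h = S y / (v * lam) / n"
      have h: "h > 0" using \<open>S y > 0\<close> v lam n0 by (simp add: h_def)
      (* the eigenvectors only see the residual, so Bessel's inequality compares S with its norm *)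
      have "S y = (\<Sum>e\<in>F. (inner e (y - orth_proj U y))\<^sup>2)"
        unfolding S_def using perp orth_proj_in[OF U] by (intro sum.cong) (auto simp: inner_diff_right)
      also have "\<dots> \<le> (norm (y - orth_proj U y))\<^sup>2" by (rule Bessel_inequality[OF F(2,1)])
      finally have "sqrt (S y) \<le> norm (y - orth_proj U y)" by (simp add: real_le_lsqrt S_def sum_nonneg)
      have "\<bar>inner w y - inner w (A \<beta>)\<bar> = \<bar>T y\<bar> * (sqrt (v * q) * sqrt h)"
      proof -
        have "T y = (inner w y - inner w (A \<beta>)) / sqrt (v * q) / sqrt h" by (simp only: T_def h_def)
        then show ?thesis using h v q_pos by (simp add: abs_divide)
      qed
      also have "\<dots> \<le> t * (sqrt (v * q) * sqrt h)"
        using h v q_pos by (intro mult_right_mono y(2)) auto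
      also have "\<dots> = k * sqrt (S y)"
        using v by (simp add: h_def k_def real_sqrt_mult real_sqrt_divide)
      also have "\<dots> \<le> k * norm (y - orth_proj U y)"
        using \<open>sqrt (S y) \<le> _\<close> t(1) q_pos lam by (intro mult_left_mono) (auto simp: k_def)
      finally show ?thesis .
    qed
    define B where "B = {y. \<bar>inner w y - inner w (A \<beta>)\<bar> \<le> k * norm (y - orth_proj U y)}"
    (* measurability is part of the claim, as a nonmeasurable event would have measure 0 *)
    have "closed B"
      unfolding B_def
      by (intro closed_Collect_le continuous_intros linear_continuous_on bounded_linear_orth_proj U)
    then have B: "B \<in> sets M" unfolding sM by (rule borel_closed)
    have "AE y in M. S y \<noteq> 0"
    proof -
      obtain e where e: "e \<in> F" using \<open>F \<noteq> {}\<close> by blast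
      have "inner e e = 1" using F(2) e by (simp add: orthonormal_def norm_eq_1)
      then have "inner (C e) e > 0" using v lam by (simp add: C_def Qe[OF e])
      then have "AE y in M. inner e y \<noteq> inner e (A \<beta>)" by (rule gaussian_marginal_AE_neq_mean[OF M])
      then show ?thesis
        using e F(1) perp[OF e, of "A \<beta>"] by (auto simp: S_def sum_nonneg_eq_0_iff U_def elim!: AE_mp)
    qed
    then have ae: "AE y in M. y \<in> {y \<in> space M. \<bar>T y\<bar> \<le> t} \<longrightarrow> y \<in> B"
      by (rule AE_mp) (use bound in \<open>auto simp: B_def\<close>)
    have "1 - \<alpha> \<le> measure (student_t n) {- t .. t}" using t(2) by simp
    also have "\<dots> = prob {y \<in> space M. \<bar>T y\<bar> \<le> t}"
      unfolding T[symmetric] by (subst measure_distr[OF Tm]) (auto intro!: arg_cong[where f=prob])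
    also have "\<dots> \<le> prob B" by (rule finite_measure_mono_AE[OF ae B])
    also have "B = {y \<in> space M. inner c \<beta> \<in> (let r = sqrt (\<tau> / (lam * real n)) * t * s y * sqrt q
         in {inner c (\<beta>_hat y) - r .. inner c (\<beta>_hat y) + r})}"
      using sets_eq_imp_space_eq[OF sM] by (auto simp: B_def Let_def radius \<beta>_hat w(2))
    finally show "1 - \<alpha> \<le> measure (P (\<beta>, v)) {y \<in> space (P (\<beta>, v)). inner c \<beta> \<in> (let r = sqrt (\<tau> / (lam * real n)) * quantile (student_t n) (1 - \<alpha> / 2) * s y * sqrt q
         in {inner c (\<beta>_hat y) - r .. inner c (\<beta>_hat y) + r})}"
      unfolding M_def t_def .
  qed
qed

end
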